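(* Let $\mathcal{X}$ be a finite non-empty set, let $A\subset\mathcal{X}$, and let $\mathcal{T}$ be a non-empty, closed, convex set of transition matrices on $\mathcal{X}$ that has separately specified rows. Then there exists a $P\in\mathcal{P}_{\mathcal{T}}^{\mathrm{H}}$ such that, for all $x\in\mathcal{X}$, $$\underline{\mathbb{E}}_{\mathcal{T}}^{\mathrm{V}}[H_A\,|\,X_0=x]=\underline{\mathbb{E}}_{\mathcal{T}}^{\mathrm{I}}[H_A\,|\,X_0=x]=\underline{\mathbb{E}}_{\mathcal{T}}^{\mathrm{H}}[H_A\,|\,X_0=x]=\mathbb{E}_P[H_A\,|\,X_0=x].$$ Moreover, there exists a (possibly different) $P\in\mathcal{P}_{\mathcal{T}}^{\mathrm{H}}$ such that, for all $x\in\mathcal{X}$, $$\overline{\mathbb{E}}_{\mathcal{T}}^{\mathrm{V}}[H_A\,|\,X_0=x]=\overline{\mathbb{E}}_{\mathcal{T}}^{\mathrm{I}}[H_A\,|\,X_0=x]=\overline{\mathbb{E}}_{\mathcal{T}}^{\mathrm{H}}[H_A\,|\,X_0=x]=\mathbb{E}_P[H_A\,|\,X_0=x].$$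
   Context: Conventions. $\mathbb{N}_0=\{0,1,2,\dots\}$; $0\cdot(+\infty)=0\cdot(-\infty)=0$. $\mathcal{L}^{+\infty}(\mathcal{X})$ is the set of functions $\mathcal{X}\to\mathbb{R}\cup\{+\infty\}$. Transition matrices. A transition matrix on $\mathcal{X}$ is a row-stochastic $|\mathcal{X}|\times|\mathcal{X}|$ matrix $T$; it acts on $f\in\mathcal{L}^{+\infty}(\mathcal{X})$ by $[Tf](x)=\sum_{y}T(x,y)f(y)$. A set $\mathcal{T}$ of transition matrices has separately specified rows if, for every choice of $T_x\in\mathcal{T}$ ($x\in\mathcal{X}$), there is a $T\in\mathcal{T}$ with $T(x,\cdot)=T_x(x,\cdot)$ for all $x\in\mathcal{X}$. Put $[\overline{T}f](x)=\sup_{T\in\mathcal{T}}[Tf](x)$ for $f\in\mathcal{L}^{+\infty}(\mathcal{X})$. Stochastic processes. $\Omega$ is the set of all paths $\omega:\mathbb{N}_0\to\mathcal{X}$, with the $\sigma$-algebra generated by the cylinder sets, and $X_n(\omega)=\omega(n)$; $X_{0:n}=(X_0,\dots,X_n)$, $x_{0:n}=(x_0,\dots,x_n)$. A stochastic process $P$ is a probability measure on $\Omega$; it is understood as given by an initial mass function together with conditional mass functions $P(X_{n+1}=\cdot\,|\,X_{0:n}=x_{0:n})$ specified for every $n\in\mathbb{N}_0$ and every $x_{0:n}\in\mathcal{X}^{n+1}$, and $P(\cdot\,|\,X_{0:n}=x_{0:n})$ is the corresponding probability measure on paths starting with $x_{0:n}$, with $\mathbb{E}_P[\cdot\,|\,X_{0:n}=x_{0:n}]$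 its expectation. $P$ is a homogeneous Markov chain with transition matrix $T$ if $P(X_{n+1}=y\,|\,X_{0:n}=x_{0:n})=T(x_n,y)$ for all $n,x_{0:n},y$. Imprecise Markov chains. $\mathcal{P}_{\mathcal{T}}^{\mathrm{H}}$ is the set of all homogeneous Markov chains whose transition matrix belongs to $\mathcal{T}$. $\mathcal{P}_{\mathcal{T}}^{\mathrm{I}}$ is the set of all stochastic processes $P$ such that for all $n$ and $x_{0:n}$ there is a $T\in\mathcal{T}$ with $P(X_{n+1}=y\,|\,X_{0:n}=x_{0:n})=T(x_n,y)$ for all $y\in\mathcal{X}$. For $\star\in\{\mathrm{H},\mathrm{I}\}$, $\underline{\mathbb{E}}_{\mathcal{T}}^{\star}[\cdot|\cdot]=\inf_{P\in\mathcal{P}_{\mathcal{T}}^{\star}}\mathbb{E}_P[\cdot|\cdot]$ and $\overline{\mathbb{E}}_{\mathcal{T}}^{\star}[\cdot|\cdot]=\sup_{P\in\mathcal{P}_{\mathcal{T}}^{\star}}\mathbb{E}_P[\cdot|\cdot]$. Game-theoretic imprecise Markov chain. Let $\mathbb{S}=\{x_{0:n}\in\mathcal{X}^{n+1}:n\in\mathbb{N}_0\}$ be the set of situations and $\Box$ the empty string. Put $\overline{Q}_{x_{0:n}}(f)=[\overline{T}f](x_n)$ for $f\in\mathcal{L}^{+\infty}(\mathcal{X})$; $\overline{Q}_\Box:\mathcal{L}^{+\infty}(\mathcal{X})\to\mathbb{R}\cup\{+\infty\}$ is any operator that maps real constants to themselves, is subadditive, monotone, and satisfies $\overline{Q}_\Box(\lambda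 f)=\lambda\overline{Q}_\Box(f)$ for all positive $\lambda\in\mathbb{R}\cup\{+\infty\}$ and non-negative $f$ (its choice does not affect what follows). A supermartingale is a map $\mathcal{M}:\mathbb{S}\cup\{\Box\}\to\mathbb{R}\cup\{-\infty,+\infty\}$ that is uniformly bounded below by a real number and satisfies $\overline{Q}_s(\mathcal{M}(s\,\cdot))\le\mathcal{M}(s)$ for all $s$, where $\mathcal{M}(s\,\cdot)$ is the function $x\mapsto\mathcal{M}(sx)$. For $f:\Omega\to\mathbb{R}\cup\{\pm\infty\}$ and $s=x_{0:n}$, $\overline{\mathbb{E}}_{\mathcal{T}}^{\mathrm{V}}[f\,|\,X_{0:n}=x_{0:n}]$ is the infimum of $\mathcal{M}(s)$ over all supermartingales $\mathcal{M}$ such that $\liminf_{m\to+\infty}\mathcal{M}(\omega(0),\dots,\omega(m))\ge f(\omega)$ for every path $\omega$ with $(\omega(0),\dots,\omega(n))=x_{0:n}$. The lower expectation is $\underline{\mathbb{E}}_{\mathcal{T}}^{\mathrm{V}}[f|\cdot]=-\overline{\mathbb{E}}_{\mathcal{T}}^{\mathrm{V}}[-f|\cdot]$. Hitting time. $H_A(\omega)=\inf\{t\in\mathbb{N}_0:\omega(t)\in A\}$, with value $+\infty$ if $A$ is never visited. *)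

theory Defs
  imports "HOL-Analysis.Analysis" "HOL-Probability.Probability"
begin

text \<open>The state space is a type \<open>'x\<close> of class \<open>finite\<close>. Situations \<open>(x\<^sub>0, \<dots>, x\<^sub>n)\<close> are non-empty
  lists over \<open>'x\<close>; the empty list is the initial situation \<open>\<box>\<close>.\<close>

definition transition_matrix :: "real^'x^'x::finite \<Rightarrow> bool" where
  "transition_matrix T \<longleftrightarrow> (\<forall>x y. 0 \<le> T $ x $ y) \<and> (\<forall>x. (\<Sum>y\<in>UNIV. T $ x $ y) = 1)"

definition separately_specified_rows :: "(real^'x^'x::finite) set \<Rightarrow> bool" where
  "separately_specified_rows \<T> \<longleftrightarrow>
     (\<forall>R. (\<forall>x. R x \<in> \<T>) \<longrightarrow> (\<exists>T\<in>\<T>. \<forall>x. T $ x = R x $ x))"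

text \<open>Functions from \<open>'x\<close> to \<open>\<real> \<union> {+\<infinity>}\<close>.\<close>

definition L_pinf :: "('x \<Rightarrow> ereal) set" where
  "L_pinf = {f. \<forall>x. f x \<noteq> -\<infinity>}"

text \<open>Only meant for \<open>f \<in> L_pinf\<close>. Multiplication on \<^typ>\<open>ereal\<close> satisfies \<open>0 * \<infinity> = 0\<close>.\<close>

definition trans_op :: "real^'x^'x::finite \<Rightarrow> ('x \<Rightarrow> ereal) \<Rightarrow> 'x \<Rightarrow> ereal" where
  "trans_op T f x = (\<Sum>y\<in>UNIV. ereal (T $ x $ y) * f y)"

definition upper_trans_op :: "(real^'x^'x::finite) set \<Rightarrow> ('x \<Rightarrow> ereal) \<Rightarrow> 'x \<Rightarrow> ereal" where
  "upper_trans_op \<T> f x = (SUP T\<in>\<T>. trans_op T f x)"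

text \<open>A stochastic process is given by its initial mass function \<open>p []\<close> and its conditional
  mass functions \<open>p [x\<^sub>0, \<dots>, x\<^sub>n] = P(X\<^sub>n\<^sub>+\<^sub>1 = \<cdot> | X\<^sub>0 = x\<^sub>0, \<dots>, X\<^sub>n = x\<^sub>n)\<close>.\<close>

type_synonym 'x process = "'x list \<Rightarrow> 'x pmf"

abbreviation prefix_of_path :: "(nat \<Rightarrow> 'x) \<Rightarrow> nat \<Rightarrow> 'x list" where
  "prefix_of_path \<omega> n \<equiv> map \<omega> [0..<n]"

abbreviation path_space :: "(nat \<Rightarrow> 'x) measure" where
  "path_space \<equiv> PiM UNIV (\<lambda>_. count_space UNIV)"

text \<open>The law of the \<open>i\<close>-th state given the states before it, under the condition that the path
  starts with \<open>s\<close>.\<close>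

definition kernel :: "'x process \<Rightarrow> 'x list \<Rightarrow> nat \<Rightarrow> (nat \<Rightarrow> 'x) \<Rightarrow> 'x measure" where
  "kernel p s i \<omega> = measure_pmf (if i < length s then return_pmf (s ! i) else p (prefix_of_path \<omega> i))"

text \<open>The measure \<open>P(\<cdot> | X\<^sub>0\<^sub>:\<^sub>n = s)\<close> on paths; for \<open>s = []\<close> it is \<open>P\<close> itself. It is the limit
  measure of the Ionescu--Tulcea theorem, and it is determined by the cylinder probabilities in
  \<open>emeasure_path_measure_cylinder\<close> below.\<close>

definition path_measure :: "'x process \<Rightarrow> 'x list \<Rightarrow> (nat \<Rightarrow> 'x) measure" where
  "path_measure p s =
     projective_family.lim UNIV
       (Ionescu_Tulcea.CI (kernel p s) (\<lambda>_. count_space UNIV)) (\<lambda>_. count_space UNIV)"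

text \<open>Difference of the integrals of the positive and the negative part. It is the usual
  expectation whenever \<open>f\<close> is measurable and one of the two is finite, in particular if
  \<open>f \<ge> 0\<close>.\<close>

definition expect :: "'x process \<Rightarrow> ((nat \<Rightarrow> 'x) \<Rightarrow> ereal) \<Rightarrow> 'x list \<Rightarrow> ereal" where
  "expect p f s =
     enn2ereal (\<integral>\<^sup>+ \<omega>. e2ennreal (f \<omega>) \<partial>path_measure p s)
     - enn2ereal (\<integral>\<^sup>+ \<omega>. e2ennreal (- f \<omega>) \<partial>path_measure p s)"

definition homogeneous_Markov_chain :: "real^'x^'x::finite \<Rightarrow> 'x process \<Rightarrow> bool" where
  "homogeneous_Markov_chain T p \<longleftrightarrow> (\<forall>s y. s \<noteq> [] \<longrightarrow> pmf (p s) y = T $ last s $ y)"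

definition processes_H :: "(real^'x^'x::finite) set \<Rightarrow> 'x process set" where
  "processes_H \<T> = {p. \<exists>T\<in>\<T>. homogeneous_Markov_chain T p}"

definition processes_I :: "(real^'x^'x::finite) set \<Rightarrow> 'x process set" where
  "processes_I \<T> = {p. \<forall>s. s \<noteq> [] \<longrightarrow> (\<exists>T\<in>\<T>. \<forall>y. pmf (p s) y = T $ last s $ y)}"

definition lower_expect :: "'x process set \<Rightarrow> ((nat \<Rightarrow> 'x) \<Rightarrow> ereal) \<Rightarrow> 'x list \<Rightarrow> ereal" where
  "lower_expect \<P> f s = (INF p\<in>\<P>. expect p f s)"

definition upper_expect :: "'x process set \<Rightarrow> ((nat \<Rightarrow> 'x) \<Rightarrow> ereal) \<Rightarrow> 'x list \<Rightarrow> ereal" where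
  "upper_expect \<P> f s = (SUP p\<in>\<P>. expect p f s)"

text \<open>The admissible local models \<open>Q\<close> for the initial situation \<open>\<box>\<close>.\<close>

definition initial_upper_model :: "(('x \<Rightarrow> ereal) \<Rightarrow> ereal) \<Rightarrow> bool" where
  "initial_upper_model Q \<longleftrightarrow>
     (\<forall>f\<in>L_pinf. Q f \<noteq> -\<infinity>) \<and>
     (\<forall>c::real. Q (\<lambda>_. ereal c) = ereal c) \<and>
     (\<forall>f\<in>L_pinf. \<forall>g\<in>L_pinf. Q (\<lambda>x. f x + g x) \<le> Q f + Q g) \<and>
     (\<forall>f\<in>L_pinf. \<forall>g\<in>L_pinf. (\<forall>x. f x \<le> g x) \<longrightarrow> Q f \<le> Q g) \<and>
     (\<forall>l>0. \<forall>f\<in>L_pinf. (\<forall>x. 0 \<le> f x) \<longrightarrow> Q (\<lambda>x. l * f x) = l * Q f)"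

definition local_upper ::
    "(('x \<Rightarrow> ereal) \<Rightarrow> ereal) \<Rightarrow> (real^'x^'x::finite) set \<Rightarrow> 'x list \<Rightarrow> ('x \<Rightarrow> ereal) \<Rightarrow> ereal" where
  "local_upper Q \<T> s f = (if s = [] then Q f else upper_trans_op \<T> f (last s))"

definition supermartingale ::
    "(('x \<Rightarrow> ereal) \<Rightarrow> ereal) \<Rightarrow> (real^'x^'x::finite) set \<Rightarrow> ('x list \<Rightarrow> ereal) \<Rightarrow> bool" where
  "supermartingale Q \<T> M \<longleftrightarrow>
     (\<exists>c::real. \<forall>s. ereal c \<le> M s) \<and> (\<forall>s. local_upper Q \<T> s (\<lambda>x. M (s @ [x])) \<le> M s)"

definition upper_expect_V ::
    "(('x \<Rightarrow> ereal) \<Rightarrow> ereal) \<Rightarrow> (real^'x^'x::finite) set \<Rightarrow>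
     ((nat \<Rightarrow> 'x) \<Rightarrow> ereal) \<Rightarrow> 'x list \<Rightarrow> ereal" where
  "upper_expect_V Q \<T> f s =
     Inf {M s | M. supermartingale Q \<T> M \<and>
            (\<forall>\<omega>. prefix_of_path \<omega> (length s) = s \<longrightarrow>
                 f \<omega> \<le> liminf (\<lambda>m. M (prefix_of_path \<omega> (Suc m))))}"

definition lower_expect_V ::
    "(('x \<Rightarrow> ereal) \<Rightarrow> ereal) \<Rightarrow> (real^'x^'x::finite) set \<Rightarrow>
     ((nat \<Rightarrow> 'x) \<Rightarrow> ereal) \<Rightarrow> 'x list \<Rightarrow> ereal" where
  "lower_expect_V Q \<T> f s = - upper_expect_V Q \<T> (\<lambda>\<omega>. - f \<omega>) s"

text \<open>The infimum of the empty set of extended reals is \<open>\<infinity>\<close>.\<close>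

definition hitting_time :: "'x set \<Rightarrow> (nat \<Rightarrow> 'x) \<Rightarrow> ereal" where
  "hitting_time A \<omega> = Inf {ereal (real t) | t. \<omega> t \<in> A}"

lemma Ionescu_Tulcea_kernel:
  fixes p :: "'x::finite process"
  shows "Ionescu_Tulcea (kernel p s) (\<lambda>_. count_space UNIV)"
proof (rule Ionescu_Tulcea.intro)
  fix i :: nat
  have "PiM {0..<i} (\<lambda>_. count_space (UNIV::'x set)) = count_space (PiE {0..<i} (\<lambda>_. UNIV))"
    by (intro count_space_PiM_finite) (auto intro: countable_finite)
  then show "kernel p s i \<in> measurable (PiM {0..<i} (\<lambda>_. count_space UNIV)) (subprob_algebra (count_space UNIV))"
    by (auto simp: kernel_def measure_pmf_in_subprob_algebra)
next
  fix i x
  show "prob_space (kernel p s i x)"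
    by (simp add: kernel_def measure_pmf.prob_space_axioms)
qed

lemma sets_path_measure:
  fixes p :: "'x::finite process"
  shows "sets (path_measure p s) = sets path_space"
proof -
  interpret IT: Ionescu_Tulcea "kernel p s" "\<lambda>_. count_space UNIV"
    by (rule Ionescu_Tulcea_kernel)
  show ?thesis unfolding path_measure_def by (rule IT.PF.sets_lim)
qed

lemma emeasure_path_measure_cylinder:
  fixes p :: "'x::finite process"
  shows "emeasure (path_measure p s) {\<omega>. prefix_of_path \<omega> (length u) = u} =
    (\<Prod>i<length u. ennreal (pmf (if i < length s then return_pmf (s ! i) else p (take i u)) (u ! i)))"
proof -
  interpret IT: Ionescu_Tulcea "kernel p s" "\<lambda>_. count_space UNIV"
    by (rule Ionescu_Tulcea_kernel)
  define r where "r n = restrict (\<lambda>i. u ! i) {0..<n}" for n :: nat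
  have PiM_eq: "PiM {0..<n} (\<lambda>_. count_space (UNIV::'x set)) = count_space (PiE {0..<n} (\<lambda>_. UNIV))" for n :: nat
    by (intro count_space_PiM_finite) (auto intro: countable_finite)
  have r_in: "{r n} \<in> sets (PiM {0..<n} (\<lambda>_. count_space UNIV))" for n
    unfolding PiM_eq r_def by auto
  have undef_in: "(\<lambda>_. undefined) \<in> space (PiM {0..<0::nat} (\<lambda>_. count_space (UNIV::'x set)))"
    by (simp add: space_PiM)
  have C: "emeasure (IT.C 0 n (\<lambda>_. undefined)) {r n} =
      (\<Prod>i<n. ennreal (pmf (if i < length s then return_pmf (s ! i) else p (take i u)) (u ! i)))"
    if "n \<le> length u" for n
    using that
  proof (induction n)
    case 0
    have "r 0 = (\<lambda>_. undefined)" by (simp add: r_def fun_eq_iff)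
    then show ?case using r_in[of 0] by (simp add: emeasure_return)
  next
    case (Suc n)
    let ?k = "ennreal (pmf (if n < length s then return_pmf (s ! n) else p (take n u)) (u ! n))"
    have eP: "emeasure (IT.eP n \<omega>) {r (Suc n)} = ?k * indicator {r n} \<omega>"
      if \<omega>: "\<omega> \<in> space (PiM {0..<n} (\<lambda>_. count_space UNIV))" for \<omega>
    proof -
      have e: "\<omega> \<in> extensional {0..<n}" using \<omega> by (simp add: space_PiM PiE_iff)
      have upd: "fun_upd \<omega> n x = r (Suc n) \<longleftrightarrow> \<omega> = r n \<and> x = u ! n" for x
      proof
        assume a: "fun_upd \<omega> n x = r (Suc n)"
        have "\<omega> i = r n i" for i
          using fun_cong[OF a, of i] e by (cases "i = n") (auto simp: r_def extensional_def restrict_def split: if_splits)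
        then show "\<omega> = r n \<and> x = u ! n"
          using fun_cong[OF a, of n] by (auto simp: r_def)
      next
        assume "\<omega> = r n \<and> x = u ! n"
        then show "fun_upd \<omega> n x = r (Suc n)"
          by (intro ext) (auto simp: r_def restrict_def)
      qed
      have "emeasure (IT.eP n \<omega>) {r (Suc n)} = emeasure (kernel p s n \<omega>) {x. fun_upd \<omega> n x = r (Suc n)}"
        using IT.emeasure_eP[OF \<omega> r_in] by (simp add: vimage_def)
      also have "\<dots> = ?k * indicator {r n} \<omega>"
      proof (cases "\<omega> = r n")
        case True
        have "prefix_of_path (r n) n = take n u"
          using Suc.prems by (intro nth_equalityI) (auto simp: r_def)
        then show ?thesis using True unfolding upd by (simp add: kernel_def emeasure_pmf_single)
      qed (simp add: upd)
      finally show ?thesis .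
    qed
    have "emeasure (IT.C 0 (Suc n) (\<lambda>_. undefined)) {r (Suc n)}
        = (\<integral>\<^sup>+ \<omega>. emeasure (IT.eP n \<omega>) {r (Suc n)} \<partial>IT.C 0 n (\<lambda>_. undefined))"
      using IT.space_C[OF undef_in, of n] IT.measurable_eP[of n] IT.sets_C[OF undef_in, of n] r_in[of "Suc n"]
      by (simp, subst emeasure_bind[where N="PiM {0..<Suc n} (\<lambda>_. count_space UNIV)"])
        (auto simp: space_PiM PiE_eq_empty_iff cong: measurable_cong_sets)
    also have "\<dots> = (\<integral>\<^sup>+ \<omega>. ?k * indicator {r n} \<omega> \<partial>IT.C 0 n (\<lambda>_. undefined))"
      using IT.space_C[OF undef_in, of n] by (intro nn_integral_cong eP) auto
    also have "\<dots> = ?k * emeasure (IT.C 0 n (\<lambda>_. undefined)) {r n}"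
      using IT.sets_C[OF undef_in, of n] r_in[of n] by (intro nn_integral_cmult_indicator) auto
    finally show ?case using Suc by (simp add: mult.commute)
  qed
  have "restrict \<omega> {0..<n} = r n \<longleftrightarrow> (\<forall>i<n. \<omega> i = u ! i)" for \<omega> n
    by (auto simp: r_def restrict_def fun_eq_iff)
  moreover have "prefix_of_path \<omega> (length u) = u \<longleftrightarrow> (\<forall>i<length u. \<omega> i = u ! i)" for \<omega>
    using list_eq_iff_nth_eq[of "prefix_of_path \<omega> (length u)" u] by auto
  ultimately have "prod_emb UNIV (\<lambda>_. count_space UNIV) {0..<length u} {r (length u)} =
      {\<omega>. prefix_of_path \<omega> (length u) = u}"
    by (auto simp add: prod_emb_def space_PiM)
  then have "emeasure (path_measure p s) {\<omega>. prefix_of_path \<omega> (length u) = u}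
      = emeasure (IT.CI {0..<length u}) {r (length u)}"
    using IT.lim[of "{0..<length u}" "{r (length u)}"] r_in by (simp add: path_measure_def)
  also have "\<dots> = emeasure (IT.C 0 (length u) (\<lambda>_. undefined)) {r (length u)}"
    using IT.emeasure_CI[of "{0..<length u}" "length u" "{r (length u)}"] r_in
    by (simp add: prod_emb_id r_def)
  finally show ?thesis using C by simp
qed

lemma prob_space_path_measure:
  fixes p :: "'x::finite process"
  shows "prob_space (path_measure p s)"
proof
  have "space (path_measure p s) = UNIV"
    using sets_eq_imp_space_eq[OF sets_path_measure[of p s]] by (simp add: space_PiM)
  then show "emeasure (path_measure p s) (space (path_measure p s)) = 1"
    using emeasure_path_measure_cylinder[of p s "[]"] by simp
qed

lemma initial_upper_model_SUP: "initial_upper_model (\<lambda>f. SUP x. f (x :: 'x))"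
proof -
  have "(SUP x. f x) \<noteq> -\<infinity>" if "f \<in> L_pinf" for f :: "'x \<Rightarrow> ereal"
    using that SUP_upper[of undefined UNIV f] by (auto simp: L_pinf_def)
  moreover have "(SUP x. f x + g x) \<le> (SUP x. f x) + (SUP x. g x)" for f g :: "'x \<Rightarrow> ereal"
    by (intro SUP_least add_mono SUP_upper) auto
  moreover have "(SUP x. f x) \<le> (SUP x. g x)" if "\<forall>x. f x \<le> g x" for f g :: "'x \<Rightarrow> ereal"
    using that by (intro SUP_mono) auto
  moreover have "(SUP x. l * f x) = l * (SUP x. f x)"
    if "0 < l" "\<forall>x. 0 \<le> f x" for l and f :: "'x \<Rightarrow> ereal"
    using that by (intro SUP_ereal_mult_left) (auto simp: less_imp_le)
  ultimately show ?thesis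
    unfolding initial_upper_model_def by simp
qed

end

theory Submission
  imports Defs
begin

text \<open>
  The four expectations form a chain of inequalities. Homogeneous chains are compatible processes, and
  a supermartingale dominates expectations under each compatible process: its expectation decreases in
  time, and Fatou's lemma passes to the limit inferior (\<open>expect_le_upper_expect_V\<close>,
  \<open>lower_expect_V_le_expect\<close>). So the upper expectations increase from homogeneous chains to compatible
  processes to supermartingales, and the lower expectations decrease. Both chains collapse once some
  homogeneous chain attains the game-theoretic value.

  That value is controlled by the capped hitting times, computed by backward recursion. Elapsed time
  plus a bound on the remaining time, frozen at the visit to \<open>A\<close>, is a supermartingale, so the increasing
  limit of the upper recursion bounds the upper expectation from above (\<open>upper_expect_V_le_up_time\<close>).
  The negative of elapsed time plus a finite-horizon value of the lower recursion is a supermartingale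
  too, so the limit of the lower recursion bounds the lower expectation from below
  (\<open>low_time_le_lower_expect_V\<close>).

  For the lower expectation, compactness provides rows that keep the capped hitting times below the
  limit at all horizons at once, and the resulting chain has expected hitting time at most the limit (\<open>ex_lower_optimal\<close>).

  For the upper expectation the limit may be infinite, and a maximising row need not exist in a useful
  sense: a row that maximises an infinite expectation may still lead to a chain with a finite one. The
  largest probability of avoiding \<open>A\<close> forever separates the two cases. Where it is positive, rows that
  preserve it give infinite expected hitting time. The states outside \<open>A\<close> where it is zero lead only to
  states where it is zero, and there the limit is bounded by a geometric argument, so that maximising
  rows exist and attain it (\<open>ex_upper_optimal\<close>). Separately specified rows allow both kinds of rows to
  be combined in one matrix.
\<close>

section \<open>Expectations under transition matrices\<close>

definition act :: "real^'x^'x::finite \<Rightarrow> ('x \<Rightarrow> real) \<Rightarrow> 'x \<Rightarrow> real" where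
  "act T f x = (\<Sum>y\<in>UNIV. T $ x $ y * f y)"

lemma trans_op_ereal: "trans_op T (\<lambda>y. ereal (f y)) x = ereal (act T f x)"
  by (simp add: trans_op_def act_def)

lemma trans_op_const:
  assumes "transition_matrix T"
  shows "trans_op T (\<lambda>_. c) x = c"
proof -
  have "trans_op T (\<lambda>_. c) x = (\<Sum>y\<in>UNIV. ereal (T $ x $ y)) * c"
    using assms unfolding trans_op_def transition_matrix_def
    by (subst sum_ereal_left_distrib) auto
  then show ?thesis
    using assms by (simp add: transition_matrix_def flip: one_ereal_def)
qed

lemma trans_op_add_real:
  assumes "transition_matrix T"
  shows "trans_op T (\<lambda>y. ereal d + f y) x = ereal d + trans_op T f x"
proof -
  have *: "ereal a * (ereal d + m) = ereal (a * d) + ereal a * m" if "0 \<le> a" for a m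
    using that by (cases m) (auto simp: algebra_simps)
  have "trans_op T (\<lambda>y. ereal d + f y) x = (\<Sum>y\<in>UNIV. ereal (T $ x $ y * d)) + trans_op T f x"
    using assms unfolding trans_op_def transition_matrix_def by (simp add: * sum.distrib del: sum_ereal)
  also have "(\<Sum>y\<in>UNIV. ereal (T $ x $ y * d)) = ereal d"
    using assms by (simp add: transition_matrix_def flip: sum_distrib_right)
  finally show ?thesis .
qed

lemma act_add: "act T (\<lambda>y. f y + g y) x = act T f x + act T g x"
  by (simp add: act_def distrib_left sum.distrib)

lemma act_scale: "act T (\<lambda>y. c * f y) x = c * act T f x"
  by (simp add: act_def sum_distrib_left mult_ac)

lemma act_minus: "act T (\<lambda>y. - f y) x = - act T f x"
  by (simp add: act_def sum_negf)

lemma act_const: "transition_matrix T \<Longrightarrow> act T (\<lambda>_. c) x = c"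
  by (simp add: act_def transition_matrix_def flip: sum_distrib_right)

text \<open>The comparison is needed only on the support of the row: the upper bound below works on a set of
  states that no row leaves before \<open>A\<close> is visited, and knows nothing about the states outside it.\<close>

lemma act_mono_support:
  assumes "transition_matrix T" "\<And>y. T $ x $ y \<noteq> 0 \<Longrightarrow> f y \<le> g y"
  shows "act T f x \<le> act T g x"
  unfolding act_def
proof (rule sum_mono)
  fix y show "T $ x $ y * f y \<le> T $ x $ y * g y"
    using assms by (cases "T $ x $ y = 0") (auto simp: transition_matrix_def intro!: mult_left_mono)
qed

lemma continuous_on_act: "continuous_on S (\<lambda>T. act T f x)"
  unfolding act_def by (intro continuous_intros)

lemma tendsto_act:
  assumes "\<And>y. ((\<lambda>n. f n y) \<longlongrightarrow> g y) F"
  shows "((\<lambda>n. act T (f n) x) \<longlongrightarrow> act T g x) F"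
  unfolding act_def by (intro tendsto_intros assms)

locale credal_matrices =
  fixes \<T> :: "(real^'x^'x::finite) set"
  assumes nonempty: "\<T> \<noteq> {}"
    and is_closed: "closed \<T>"
    and stochastic: "T \<in> \<T> \<Longrightarrow> transition_matrix T"
begin

lemma compact_set: "compact \<T>"
proof -
  have "norm T \<le> real CARD('x) * real CARD('x)" if "T \<in> \<T>" for T
  proof -
    have le1: "\<bar>T $ x $ y\<bar> \<le> 1" for x y
    proof -
      have "T $ x $ y \<le> (\<Sum>y\<in>UNIV. T $ x $ y)"
        using stochastic[OF that] by (intro member_le_sum) (auto simp: transition_matrix_def)
      then show ?thesis using stochastic[OF that] by (auto simp: transition_matrix_def)
    qed
    have "norm (T $ x) \<le> real CARD('x)" for x
      using order_trans[OF norm_le_l1_cart sum_mono[where g="\<lambda>_. 1"]] le1 by fastforce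
    then have "(\<Sum>x\<in>UNIV. norm (T $ x)) \<le> (\<Sum>x\<in>(UNIV::'x set). real CARD('x))"
      by (intro sum_mono) auto
    moreover have "norm T \<le> (\<Sum>x\<in>UNIV. norm (T $ x))"
      unfolding norm_vec_def by (intro L2_set_le_sum) auto
    ultimately show ?thesis by simp
  qed
  then have "bounded \<T>" by (auto simp: bounded_iff)
  then show ?thesis using is_closed by (simp add: compact_eq_bounded_closed)
qed

lemma ex_maximal_row:
  "\<exists>T\<in>\<T>. \<forall>S\<in>\<T>. act S f x \<le> act T f x"
  using continuous_attains_sup[OF compact_set nonempty continuous_on_act[of _ f x]] by blast

definition upper :: "('x \<Rightarrow> real) \<Rightarrow> 'x \<Rightarrow> real" where
  "upper f x = (SUP T\<in>\<T>. act T f x)"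

definition lower :: "('x \<Rightarrow> real) \<Rightarrow> 'x \<Rightarrow> real" where
  "lower f x = - upper (\<lambda>y. - f y) x"

lemma upper_attained: "\<exists>T\<in>\<T>. upper f x = act T f x"
proof -
  obtain T where T: "T \<in> \<T>" "\<And>S. S \<in> \<T> \<Longrightarrow> act S f x \<le> act T f x"
    using ex_maximal_row by blast
  then have "upper f x = act T f x"
    unfolding upper_def by (intro cSup_eq_maximum) auto
  then show ?thesis using T by blast
qed

lemma act_le_upper: "T \<in> \<T> \<Longrightarrow> act T f x \<le> upper f x"
proof -
  obtain S where "S \<in> \<T>" "\<And>S'. S' \<in> \<T> \<Longrightarrow> act S' f x \<le> act S f x"
    using ex_maximal_row by blast
  then show "T \<in> \<T> \<Longrightarrow> act T f x \<le> upper f x"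
    unfolding upper_def by (intro cSUP_upper bdd_aboveI) auto
qed

lemma lower_attained: "\<exists>T\<in>\<T>. lower f x = act T f x"
  using upper_attained[of "\<lambda>y. - f y" x] by (force simp: lower_def act_minus)

lemma lower_le_act: "T \<in> \<T> \<Longrightarrow> lower f x \<le> act T f x"
  using act_le_upper[of T "\<lambda>y. - f y" x] by (simp add: lower_def act_minus)

lemma upper_mono: assumes "\<And>y. f y \<le> g y" shows "upper f x \<le> upper g x"
proof -
  obtain T where T: "T \<in> \<T>" "upper f x = act T f x" using upper_attained by blast
  have "act T f x \<le> act T g x" by (intro act_mono_support stochastic T assms)
  then show ?thesis using T act_le_upper[of T g x] by linarith
qed

lemma lower_mono: assumes "\<And>y. f y \<le> g y" shows "lower f x \<le> lower g x"
  unfolding lower_def using upper_mono[of "\<lambda>y. - g y" "\<lambda>y. - f y"] assms by simp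

text \<open>The rows that do at least as well as \<open>c\<close> against \<open>f n\<close> form a decreasing sequence of non-empty compact
  sets, so one matrix does so for all \<open>n\<close> at once. This is what lets an optimal matrix for the limit
  be extracted from optimal matrices for finite horizons.\<close>

lemma ex_uniform_matrix:
  assumes dec: "\<And>n y. f (Suc n) y \<le> f n y"
    and ex: "\<And>n. \<exists>T\<in>\<T>. c \<le> act T (f n) x"
  shows "\<exists>T\<in>\<T>. \<forall>n. c \<le> act T (f n) x"
proof -
  let ?K = "\<lambda>n. {T \<in> \<T>. c \<le> act T (f n) x}"
  have "?K n = \<T> \<inter> {T. c \<le> act T (f n) x}" for n by auto
  moreover have "closed {T. c \<le> act T (f n) x}" for n
    by (intro closed_Collect_le continuous_on_const continuous_on_act)
  ultimately have "compact (?K n)" for n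
    using compact_Int_closed[OF compact_set] by metis
  moreover have "?K n \<noteq> {}" for n using ex by blast
  moreover have "?K n \<subseteq> ?K m" if "m \<le> n" for m n
  proof -
    have "f n y \<le> f m y" for y using lift_Suc_antimono_le[of "\<lambda>n. f n y"] dec that by blast
    then have "T \<in> \<T> \<Longrightarrow> act T (f n) x \<le> act T (f m) x" for T
      by (intro act_mono_support stochastic)
    then show ?thesis by force
  qed
  ultimately have "(\<Inter>n. ?K n) \<noteq> {}" by (rule compact_nest)
  then show ?thesis by blast
qed

end

section \<open>Processes stopped at the hitting time\<close>

text \<open>Index in \<open>s\<close> of the current state of the path that is frozen at its first visit to \<open>A\<close>.\<close>

definition stop_index :: "'x set \<Rightarrow> 'x list \<Rightarrow> nat" where
  "stop_index A s = min (length (takeWhile (\<lambda>x. x \<notin> A) s)) (length s - 1)"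

text \<open>The value \<open>\<infinity>\<close> at the initial situation makes the supermartingale inequality there hold for every
  local model \<open>Q\<close>; only the values after the first state matter for conditional expectations.\<close>

definition stopped :: "'x set \<Rightarrow> (nat \<Rightarrow> 'x \<Rightarrow> ereal) \<Rightarrow> 'x list \<Rightarrow> ereal" where
  "stopped A F s = (if s = [] then \<infinity> else F (stop_index A s) (s ! stop_index A s))"

lemma stop_index_hit:
  assumes "x \<in> set s" "x \<in> A"
  shows "stop_index A (s @ [y]) = stop_index A s" "stop_index A s < length s"
proof -
  have "length (takeWhile (\<lambda>x. x \<notin> A) s) < length s"
    using assms by (induction s) auto
  moreover have "takeWhile (\<lambda>x. x \<notin> A) (s @ [y]) = takeWhile (\<lambda>x. x \<notin> A) s"
    using assms by (intro takeWhile_append1) auto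
  ultimately show "stop_index A (s @ [y]) = stop_index A s" "stop_index A s < length s"
    by (auto simp: stop_index_def)
qed

lemma stop_index_not_hit:
  assumes "set s \<inter> A = {}"
  shows "stop_index A (s @ [y]) = length s" "stop_index A s = length s - 1"
proof -
  have *: "takeWhile (\<lambda>x. x \<notin> A) s = s" 
    using assms by (auto simp: takeWhile_eq_all_conv)
  moreover have "takeWhile (\<lambda>x. x \<notin> A) (s @ [y]) = s @ takeWhile (\<lambda>x. x \<notin> A) [y]"
    using assms by (intro takeWhile_append2) auto
  ultimately show "stop_index A (s @ [y]) = length s" "stop_index A s = length s - 1"
    by (simp_all add: stop_index_def *)
qed

text \<open>Before \<open>A\<close> is visited this is the one-step inequality for \<open>F\<close>; after the visit the process is constant.\<close>

lemma stopped_supermartingale: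
  assumes T: "\<And>T. T \<in> \<T> \<Longrightarrow> transition_matrix T"
    and bound: "\<And>n x. ereal c \<le> F n x"
    and step: "\<And>n x T. x \<notin> A \<Longrightarrow> T \<in> \<T> \<Longrightarrow> trans_op T (F (Suc n)) x \<le> F n x"
  shows "supermartingale Q \<T> (stopped A F)"
proof -
  have "local_upper Q \<T> s (\<lambda>y. stopped A F (s @ [y])) \<le> stopped A F s" for s
  proof (cases "s = []")
    case True
    then show ?thesis by (simp add: stopped_def)
  next
    case False
    have "trans_op T (\<lambda>y. stopped A F (s @ [y])) (last s) \<le> stopped A F s" if "T \<in> \<T>" for T
    proof (cases "set s \<inter> A = {}")
      case True
      have "trans_op T (F (Suc (length s - 1))) (last s) \<le> F (length s - 1) (last s)"
        using True False that last_in_set by (intro step) auto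
      then show ?thesis
        using False by (simp add: stopped_def stop_index_not_hit[OF True] nth_append last_conv_nth)
    next
      case hit: False
      then obtain x where "x \<in> set s" "x \<in> A" by blast
      then show ?thesis
        using False by (simp add: stopped_def stop_index_hit nth_append trans_op_const T that)
    qed
    then show ?thesis
      using False by (auto simp: local_upper_def upper_trans_op_def intro: SUP_least)
  qed
  moreover have "ereal c \<le> stopped A F s" for s
    using bound by (simp add: stopped_def)
  ultimately show ?thesis unfolding supermartingale_def by blast
qed

lemma hitting_time_hit:
  assumes "\<omega> t \<in> A" "\<And>i. i < t \<Longrightarrow> \<omega> i \<notin> A"
  shows "hitting_time A \<omega> = ereal (real t)"
  unfolding hitting_time_def using assms by (intro Inf_eqI) (auto simp: not_less[symmetric])

lemma hitting_time_not_hit: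
  assumes "\<And>i. \<omega> i \<notin> A" shows "hitting_time A \<omega> = \<infinity>"
  using assms by (simp add: hitting_time_def top_ereal_def)

lemma liminf_stopped_hit:
  assumes hit: "\<omega> t \<in> A" "\<And>i. i < t \<Longrightarrow> \<omega> i \<notin> A"
  shows "liminf (\<lambda>m. stopped A F (prefix_of_path \<omega> (Suc m))) = F t (\<omega> t)"
proof -
  have *: "stop_index A (prefix_of_path \<omega> (Suc t + k)) = t" for k
  proof (induction k)
    case 0
    have "set (prefix_of_path \<omega> t) \<inter> A = {}" using hit by auto
    from stop_index_not_hit(1)[OF this, of "\<omega> t"] show ?case by simp
  next
    case (Suc k)
    have "\<omega> t \<in> set (prefix_of_path \<omega> (Suc t + k))"
      by (simp del: upt_Suc)
    from stop_index_hit(1)[OF this hit(1), of "\<omega> (Suc t + k)"] Suc show ?case by simp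
  qed
  have "stopped A F (prefix_of_path \<omega> (Suc m)) = F t (\<omega> t)" if "t \<le> m" for m
    using *[of "m - t"] that by (simp add: stopped_def del: upt_Suc)
  then have "eventually (\<lambda>m. stopped A F (prefix_of_path \<omega> (Suc m)) = F t (\<omega> t)) sequentially"
    by (auto simp: eventually_sequentially)
  then have "(\<lambda>m. stopped A F (prefix_of_path \<omega> (Suc m))) \<longlonglongrightarrow> F t (\<omega> t)"
    by (rule tendsto_eventually)
  then show ?thesis by (intro lim_imp_Liminf) auto
qed

lemma stopped_not_hit:
  assumes "\<And>i. \<omega> i \<notin> A"
  shows "stopped A F (prefix_of_path \<omega> (Suc m)) = F m (\<omega> m)"
proof -
  have "set (prefix_of_path \<omega> (Suc m)) \<inter> A = {}" using assms by auto
  then have "stop_index A (prefix_of_path \<omega> (Suc m)) = m"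
    by (simp add: stop_index_not_hit(2) del: upt_Suc)
  then show ?thesis by (simp add: stopped_def del: upt_Suc)
qed

text \<open>A stopped process has a limit along each path that visits \<open>A\<close>, namely the value of \<open>F\<close> at the visit. So
  it dominates a function \<open>\<phi>\<close> of the hitting time as soon as \<open>F\<close> does so on \<open>A\<close> and along the paths that
  never visit \<open>A\<close>. With \<open>\<phi>\<close> the identity this yields upper bounds for the hitting time, with \<open>\<phi>\<close> the
  negation it yields lower bounds.\<close>

lemma upper_expect_V_le:
  assumes T: "\<And>T. T \<in> \<T> \<Longrightarrow> transition_matrix T"
    and bound: "\<And>n x. ereal c \<le> F n x"
    and step: "\<And>n x T. x \<notin> A \<Longrightarrow> T \<in> \<T> \<Longrightarrow> trans_op T (F (Suc n)) x \<le> F n x"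
    and hit: "\<And>t x. x \<in> A \<Longrightarrow> \<phi> (ereal (real t)) \<le> F t x"
    and not_hit: "\<And>\<omega>. (\<And>i. \<omega> i \<notin> A) \<Longrightarrow> \<phi> \<infinity> \<le> liminf (\<lambda>m. F m (\<omega> m))"
  shows "upper_expect_V Q \<T> (\<lambda>\<omega>. \<phi> (hitting_time A \<omega>)) [x] \<le> F 0 x"
proof -
  have "\<phi> (hitting_time A \<omega>) \<le> liminf (\<lambda>m. stopped A F (prefix_of_path \<omega> (Suc m)))" for \<omega>
  proof (cases "\<exists>t. \<omega> t \<in> A")
    case True
    define t where "t = (LEAST t. \<omega> t \<in> A)"
    have t: "\<omega> t \<in> A" "\<And>i. i < t \<Longrightarrow> \<omega> i \<notin> A"
      unfolding t_def using True by (auto intro: LeastI_ex dest: not_less_Least)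
    then show ?thesis using hit by (simp add: hitting_time_hit liminf_stopped_hit del: upt_Suc)
  next
    case False
    then show ?thesis
      using not_hit by (simp add: hitting_time_not_hit stopped_not_hit del: upt_Suc)
  qed
  moreover have "supermartingale Q \<T> (stopped A F)"
    by (rule stopped_supermartingale[where c = c]) (use T bound step in auto)
  ultimately have "upper_expect_V Q \<T> (\<lambda>\<omega>. \<phi> (hitting_time A \<omega>)) [x] \<le> stopped A F [x]"
    unfolding upper_expect_V_def by (intro Inf_lower) blast
  also have "\<dots> = F 0 x" by (simp add: stopped_def stop_index_def)
  finally show ?thesis .
qed

text \<open>The supermartingale is the elapsed time plus a bound on the expected remaining time.\<close>

lemma upper_expect_V_le_supersolution:
  assumes T: "\<And>T. T \<in> \<T> \<Longrightarrow> transition_matrix T"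
    and nonneg: "\<And>x. 0 \<le> h x"
    and super: "\<And>x T. x \<notin> A \<Longrightarrow> T \<in> \<T> \<Longrightarrow> 1 + trans_op T h x \<le> h x"
  shows "upper_expect_V Q \<T> (hitting_time A) [x] \<le> h x"
proof -
  let ?F = "\<lambda>n y. ereal (real n) + h y"
  have "upper_expect_V Q \<T> (\<lambda>\<omega>. id (hitting_time A \<omega>)) [x] \<le> ?F 0 x"
  proof (rule upper_expect_V_le[where c = 0])
    fix n x T assume *: "x \<notin> A" "T \<in> \<T>"
    have "trans_op T (?F (Suc n)) x = ereal (real n) + (1 + trans_op T h x)"
      by (simp add: trans_op_add_real[OF T[OF *(2)]] one_ereal_def flip: add.assoc)
         (simp add: add.commute)
    also have "\<dots> \<le> ereal (real n) + h x" by (intro add_left_mono super *)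
    finally show "trans_op T (?F (Suc n)) x \<le> ?F n x" .
  next
    fix \<omega> :: "nat \<Rightarrow> 'a"
    have "(\<lambda>m. ereal (real m)) \<longlonglongrightarrow> \<infinity>"
      by (intro id_nat_ereal_tendsto_PInf)
    then have "\<infinity> = liminf (\<lambda>m. ereal (real m))"
      using lim_imp_Liminf[symmetric] by (metis sequentially_bot)
    also have "\<dots> \<le> liminf (\<lambda>m. ereal (real m) + h (\<omega> m))"
      using nonneg by (intro Liminf_mono always_eventually) (auto intro: add_increasing2)
    finally show "id \<infinity> \<le> liminf (\<lambda>m. ereal (real m) + h (\<omega> m))" by simp
  qed (use nonneg T in \<open>auto intro: add_increasing2\<close>)
  then show ?thesis by simp
qed

text \<open>Supermartingales must be bounded below, so the negated elapsed time plus remaining time cannot be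
  used as it stands. Truncation at the horizon \<open>k\<close> repairs this: \<open>h (k - n)\<close> is a lower bound for the time
  that remains after \<open>n\<close> steps, counted up to the horizon only.\<close>

lemma subsolution_le_lower_expect_V:
  fixes h :: "nat \<Rightarrow> 'x::finite \<Rightarrow> real"
  assumes T: "\<And>T. T \<in> \<T> \<Longrightarrow> transition_matrix T"
    and h0: "\<And>x. h 0 x = 0" and hA: "\<And>n x. x \<in> A \<Longrightarrow> h n x = 0"
    and sub: "\<And>n x T. x \<notin> A \<Longrightarrow> T \<in> \<T> \<Longrightarrow> h (Suc n) x \<le> 1 + act T (h n) x"
  shows "ereal (h k x) \<le> lower_expect_V Q \<T> (hitting_time A) [x]"
proof -
  \<comment> \<open>Beyond the horizon \<open>k - n = 0\<close>, so that \<open>?F\<close> is constant there.\<close>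
  let ?F = "\<lambda>n y. ereal (- (real (min n k) + h (k - n) y))"
  define B where "B = Max ((\<lambda>(n, y). h n y) ` ({..k} \<times> UNIV))"
  have B: "h n y \<le> B" if "n \<le> k" for n y
    unfolding B_def using that by (intro Max_ge) auto
  have "upper_expect_V Q \<T> (\<lambda>\<omega>. uminus (hitting_time A \<omega>)) [x] \<le> ?F 0 x"
  proof (rule upper_expect_V_le[where c = "- (real k + B)"])
    fix n y show "ereal (- (real k + B)) \<le> ?F n y"
      using B[of "k - n" y] by (auto simp: min_def)
  next
    fix n x T assume *: "x \<notin> A" "T \<in> \<T>"
    show "trans_op T (?F (Suc n)) x \<le> ?F n x"
    proof (cases "n < k")
      case True
      then have "h (k - n) x \<le> 1 + act T (h (k - Suc n)) x"
        using sub[OF *, of "k - Suc n"] by (simp add: Suc_diff_Suc)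
      then show ?thesis
        using True T[OF *(2)] unfolding trans_op_ereal act_minus act_add
        by (simp add: act_const min_def)
    next
      case False
      then show ?thesis
        using T[OF *(2)] unfolding trans_op_ereal act_minus act_add
        by (simp add: act_const h0 min_def)
    qed
  qed (use T hA in auto)
  then have "- ?F 0 x \<le> lower_expect_V Q \<T> (hitting_time A) [x]"
    unfolding lower_expect_V_def ereal_minus_le_minus by simp
  then show ?thesis by simp
qed

section \<open>Supermartingales dominate expectations\<close>

lemma space_path_measure: "space (path_measure p s) = (UNIV :: (nat \<Rightarrow> 'x::finite) set)"
  using sets_eq_imp_space_eq[OF sets_path_measure[of p s]] by (simp add: space_PiM)

lemma measurable_component_path_measure:
  fixes p :: "'x::finite process"
  shows "(\<lambda>\<omega>. \<omega> i) \<in> path_measure p s \<rightarrow>\<^sub>M count_space UNIV"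
  by (subst measurable_cong_sets[OF sets_path_measure refl]) simp

lemma cylinder_in_sets:
  fixes p :: "'x::finite process"
  shows "{\<omega>. prefix_of_path \<omega> (length u) = u} \<in> sets (path_measure p s)"
proof -
  have "{\<omega> \<in> space (path_measure p s). \<omega> i = y} \<in> sets (path_measure p s)" for i y
    using measurable_sets[OF measurable_component_path_measure, of "{y}" i p s]
    by (simp add: vimage_def space_path_measure)
  then have "{\<omega> \<in> space (path_measure p s). \<forall>i\<in>{..<length u}. \<omega> i = u ! i} \<in> sets (path_measure p s)"
    by (intro sets.sets_Collect_finite_All) auto
  moreover have "prefix_of_path \<omega> (length u) = u \<longleftrightarrow> (\<forall>i\<in>{..<length u}. \<omega> i = u ! i)" for \<omega>
    using list_eq_iff_nth_eq[of "prefix_of_path \<omega> (length u)" u] by auto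
  ultimately show ?thesis by (simp only: space_path_measure UNIV_I simp_thms)
qed

lemma measurable_prefix:
  fixes p :: "'x::finite process"
  shows "(\<lambda>\<omega>. prefix_of_path \<omega> n) \<in> path_measure p s \<rightarrow>\<^sub>M count_space UNIV"
proof -
  have "(\<lambda>\<omega>. prefix_of_path \<omega> n) -` {u} \<inter> space (path_measure p s) \<in> sets (path_measure p s)" for u
  proof (cases "length u = n")
    case True
    then show ?thesis
      using cylinder_in_sets[of u p s] by (simp add: space_path_measure vimage_def)
  next
    case False
    then have "(\<lambda>\<omega>. prefix_of_path \<omega> n) -` {u} = {}" by auto
    then show ?thesis by simp
  qed
  moreover have "countable (UNIV :: 'x list set)" by (rule countableI_type)
  ultimately show ?thesis
    by (subst measurable_count_space_eq2_countable) blast+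
qed

text \<open>The integral of a function of finitely many states is a finite sum over cylinders, whose probabilities
  are products of conditional probabilities.\<close>

lemma nn_integral_prefix:
  fixes p :: "'x::finite process" and G :: "'x list \<Rightarrow> ennreal"
  shows "(\<integral>\<^sup>+\<omega>. G (prefix_of_path \<omega> n) \<partial>path_measure p s) =
    (\<Sum>u | length u = n. G u * emeasure (path_measure p s) {\<omega>. prefix_of_path \<omega> (length u) = u})"
proof -
  have fin: "finite {u :: 'x list. length u = n}"
    using finite_lists_length_eq[of "UNIV::'x set" n] by simp
  have eq: "G (prefix_of_path \<omega> n) =
      (\<Sum>u | length u = n. G u * indicator {\<omega>. prefix_of_path \<omega> (length u) = u} \<omega>)" for \<omega>
  proof -
    have "(\<Sum>u | length u = n. G u * indicator {\<omega>. prefix_of_path \<omega> (length u) = u} \<omega>) =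
        (\<Sum>u | length u = n. if u = prefix_of_path \<omega> n then G u else 0)"
      by (intro sum.cong refl) (auto simp: indicator_def)
    then show ?thesis using fin by simp
  qed
  show ?thesis
    unfolding eq
  proof (subst nn_integral_sum)
    fix u :: "'x list"
    show "(\<lambda>\<omega>. G u * indicator {\<omega>. prefix_of_path \<omega> (length u) = u} \<omega>) \<in> borel_measurable (path_measure p s)"
      by (intro borel_measurable_times_ennreal borel_measurable_const borel_measurable_indicator cylinder_in_sets)
  qed (intro sum.cong refl nn_integral_cmult_indicator cylinder_in_sets)
qed

lemma hitting_time_eq_INF: "hitting_time A \<omega> = (INF t. if \<omega> t \<in> A then ereal (real t) else \<infinity>)"
proof (rule antisym)
  show "hitting_time A \<omega> \<le> (INF t. if \<omega> t \<in> A then ereal (real t) else \<infinity>)"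
  proof (rule INF_greatest)
    fix t
    have "\<omega> t \<in> A \<Longrightarrow> hitting_time A \<omega> \<le> ereal (real t)"
      unfolding hitting_time_def by (rule Inf_lower) blast
    then show "hitting_time A \<omega> \<le> (if \<omega> t \<in> A then ereal (real t) else \<infinity>)" by simp
  qed
  show "(INF t. if \<omega> t \<in> A then ereal (real t) else \<infinity>) \<le> hitting_time A \<omega>"
    unfolding hitting_time_def
  proof (rule Inf_greatest, clarify)
    fix t assume "\<omega> t \<in> A"
    then show "(INF t. if \<omega> t \<in> A then ereal (real t) else \<infinity>) \<le> ereal (real t)"
      by (intro INF_lower2[of t]) simp_all
  qed
qed

lemma measurable_hitting_time:
  fixes p :: "'x::finite process"
  shows "hitting_time A \<in> borel_measurable (path_measure p s)"
proof -
  have "(\<lambda>\<omega>. if \<omega> t \<in> A then ereal (real t) else \<infinity>) \<in> borel_measurable (path_measure p s)" for t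
    by (rule measurable_compose[OF measurable_component_path_measure]) simp
  then show ?thesis
    unfolding hitting_time_eq_INF[abs_def] by (intro borel_measurable_INF) auto
qed

lemma hitting_time_nonneg: "0 \<le> hitting_time A \<omega>"
  unfolding hitting_time_def by (intro Inf_greatest) auto

lemma expect_hitting_time:
  "expect p (hitting_time A) s = enn2ereal (\<integral>\<^sup>+ \<omega>. e2ennreal (hitting_time A \<omega>) \<partial>path_measure p s)"
  by (simp add: expect_def e2ennreal_neg hitting_time_nonneg zero_ennreal.rep_eq)

lemma AE_path_measure_starts_at:
  fixes p :: "'x::finite process"
  shows "AE \<omega> in path_measure p [x]. prefix_of_path \<omega> 1 = [x]"
proof -
  interpret prob_space "path_measure p [x]" by (rule prob_space_path_measure)
  have "emeasure (path_measure p [x]) {\<omega>. prefix_of_path \<omega> (length [x]) = [x]} = 1"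
    by (subst emeasure_path_measure_cylinder) simp
  then have "prob {\<omega>. prefix_of_path \<omega> (length [x]) = [x]} = 1"
    unfolding measure_def by (metis enn2real_1)
  then have "AE \<omega> in path_measure p [x]. \<omega> \<in> {\<omega>. prefix_of_path \<omega> (length [x]) = [x]}"
    by (rule iffD2[OF AE_in_set_eq_1[OF cylinder_in_sets]])
  then show ?thesis by (rule eventually_mono) simp
qed

text \<open>Carries the local supermartingale inequality from extended reals over to the type in which
  nonnegative integrals take their values.\<close>

lemma local_ennreal_step:
  fixes T :: "real^'x^'x::finite"
  assumes "transition_matrix T" "\<And>y. 0 \<le> m y" "trans_op T m x \<le> b"
  shows "(\<Sum>y\<in>UNIV. ennreal (T $ x $ y) * e2ennreal (m y)) \<le> e2ennreal b"
proof -
  have "enn2ereal (\<Sum>y\<in>UNIV. ennreal (T $ x $ y) * e2ennreal (m y)) =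
      (\<Sum>y\<in>UNIV. enn2ereal (ennreal (T $ x $ y) * e2ennreal (m y)))"
    by (rule sum_enn2ereal[symmetric]) simp
  also have "\<dots> = trans_op T m x"
    unfolding trans_op_def using assms
    by (intro sum.cong) (auto simp: times_ennreal.rep_eq enn2ereal_e2ennreal transition_matrix_def)
  finally have "e2ennreal (trans_op T m x) = (\<Sum>y\<in>UNIV. ennreal (T $ x $ y) * e2ennreal (m y))"
    by (metis e2ennreal_enn2ereal)
  then show ?thesis using e2ennreal_mono[OF assms(3)] by simp
qed

text \<open>Under a compatible process the local upper expectation dominates the conditional expectation, so the
  expectation of a supermartingale decreases along time. The shift by \<open>d\<close> makes it nonnegative.\<close>

lemma supermartingale_integral_le:
  fixes p :: "'x::finite process"
  assumes \<T>: "\<And>T. T \<in> \<T> \<Longrightarrow> transition_matrix T"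
    and M: "supermartingale Q \<T> M" and d: "\<And>s. 0 \<le> ereal d + M s"
    and p: "p \<in> processes_I \<T>"
  shows "(\<integral>\<^sup>+\<omega>. e2ennreal (ereal d + M (prefix_of_path \<omega> (Suc n))) \<partial>path_measure p [x])
    \<le> e2ennreal (ereal d + M [x])"
proof (induction n)
  case 0
  have "e2ennreal (ereal d + M (prefix_of_path \<omega> (Suc 0))) = e2ennreal (ereal d + M [x])"
    if "prefix_of_path \<omega> 1 = [x]" for \<omega>
    using that by simp
  then have "(\<integral>\<^sup>+\<omega>. e2ennreal (ereal d + M (prefix_of_path \<omega> (Suc 0))) \<partial>path_measure p [x])
      = (\<integral>\<^sup>+\<omega>. e2ennreal (ereal d + M [x]) \<partial>path_measure p [x])"
    using AE_path_measure_starts_at[where p = p and x = x] by (intro nn_integral_cong_AE) (auto elim: eventually_mono)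
  also have "\<dots> = e2ennreal (ereal d + M [x])"
    using prob_space.emeasure_space_1[OF prob_space_path_measure[of p "[x]"]] by simp
  finally show ?case by simp
next
  case (Suc n)
  let ?G = "\<lambda>u :: 'x list. e2ennreal (ereal d + M u)"
  let ?C = "\<lambda>u :: 'x list. emeasure (path_measure p [x]) {\<omega>. prefix_of_path \<omega> (length u) = u}"
  have C_snoc: "?C (u @ [y]) = ?C u * ennreal (pmf (p u) y)" if "u \<noteq> []" for u y
    unfolding emeasure_path_measure_cylinder using that
    by (auto simp: nth_append less_Suc_eq intro!: prod.cong arg_cong2[where f="(*)"])
  have step: "(\<Sum>y\<in>UNIV. ennreal (pmf (p u) y) * ?G (u @ [y])) \<le> ?G u" if "u \<noteq> []" for u
  proof -
    have "\<exists>T\<in>\<T>. \<forall>y. pmf (p u) y = T $ last u $ y"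
      using p that unfolding processes_I_def mem_Collect_eq by (elim allE impE)
    then obtain T where T: "T \<in> \<T>" "\<And>y. pmf (p u) y = T $ last u $ y" by blast
    have "trans_op T (\<lambda>y. M (u @ [y])) (last u) \<le> upper_trans_op \<T> (\<lambda>y. M (u @ [y])) (last u)"
      unfolding upper_trans_op_def using T(1) by (rule SUP_upper)
    also have "\<dots> \<le> M u"
    proof -
      have "local_upper Q \<T> u (\<lambda>y. M (u @ [y])) \<le> M u"
        using M unfolding supermartingale_def by (elim conjE) (erule spec)
      then show ?thesis using that by (simp add: local_upper_def)
    qed
    finally have "trans_op T (\<lambda>y. ereal d + M (u @ [y])) (last u) \<le> ereal d + M u"
      by (simp add: trans_op_add_real[OF \<T>[OF T(1)]] add_left_mono)
    from local_ennreal_step[OF \<T>[OF T(1)] d this] show ?thesis by (simp add: T(2))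
  qed
  have bij: "bij_betw (\<lambda>(u, y). u @ [y]) ({u :: 'x list. length u = Suc n} \<times> UNIV) {u. length u = Suc (Suc n)}"
    by (rule bij_betwI[where g="\<lambda>u. (butlast u, last u)"])
      (auto intro!: append_butlast_last_id)
  have "(\<integral>\<^sup>+\<omega>. ?G (prefix_of_path \<omega> (Suc (Suc n))) \<partial>path_measure p [x])
      = (\<Sum>u | length u = Suc (Suc n). ?G u * ?C u)"
    by (rule nn_integral_prefix)
  also have "\<dots> = (\<Sum>(u, y)\<in>{u. length u = Suc n} \<times> UNIV. ?G (u @ [y]) * ?C (u @ [y]))"
    by (subst sum.reindex_bij_betw[OF bij, symmetric]) (simp add: case_prod_unfold)
  also have "\<dots> = (\<Sum>u | length u = Suc n. \<Sum>y\<in>UNIV. ?G (u @ [y]) * ?C (u @ [y]))"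
    by (rule sum.cartesian_product[symmetric])
  also have "\<dots> = (\<Sum>u | length u = Suc n. ?C u * (\<Sum>y\<in>UNIV. ennreal (pmf (p u) y) * ?G (u @ [y])))"
    unfolding sum_distrib_left
  proof (intro sum.cong refl)
    fix u :: "'x list" and y assume "u \<in> {u. length u = Suc n}"
    then have "u \<noteq> []" by auto
    show "?G (u @ [y]) * ?C (u @ [y]) = ?C u * (ennreal (pmf (p u) y) * ?G (u @ [y]))"
      unfolding C_snoc[OF \<open>u \<noteq> []\<close>] by (simp only: mult_ac)
  qed
  also have "\<dots> \<le> (\<Sum>u | length u = Suc n. ?C u * ?G u)"
    by (intro sum_mono mult_left_mono step) auto
  also have "\<dots> = (\<integral>\<^sup>+\<omega>. ?G (prefix_of_path \<omega> (Suc n)) \<partial>path_measure p [x])"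
    by (subst nn_integral_prefix) (simp only: mult.commute)
  also have "\<dots> \<le> ?G [x]" by (rule Suc.IH)
  finally show ?case .
qed

text \<open>Fatou's lemma turns the bounds at fixed times into a bound for the limit inferior.\<close>

lemma supermartingale_liminf_integral_le:
  fixes p :: "'x::finite process"
  assumes \<T>: "\<And>T. T \<in> \<T> \<Longrightarrow> transition_matrix T"
    and M: "supermartingale Q \<T> M" and d: "\<And>s. 0 \<le> ereal d + M s"
    and p: "p \<in> processes_I \<T>"
  shows "(\<integral>\<^sup>+\<omega>. e2ennreal (ereal d + liminf (\<lambda>n. M (prefix_of_path \<omega> (Suc n)))) \<partial>path_measure p [x])
    \<le> e2ennreal (ereal d + M [x])"
proof -
  have "e2ennreal (ereal d + liminf (\<lambda>n. M (prefix_of_path \<omega> (Suc n))))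
      = liminf (\<lambda>n. e2ennreal (ereal d + M (prefix_of_path \<omega> (Suc n))))" for \<omega>
  proof (rule Liminf_compose_continuous_mono[symmetric])
    have "continuous_on UNIV (\<lambda>z. ereal d + z)"
      unfolding continuous_on_def add.commute[of "ereal d"]
      by (intro ballI tendsto_add_left_ereal tendsto_ident_at) simp
    then show "continuous_on UNIV (\<lambda>z. e2ennreal (ereal d + z))"
      by (rule continuous_on_compose2[OF continuous_on_e2ennreal]) auto
    show "mono (\<lambda>z. e2ennreal (ereal d + z))"
      by (intro monoI e2ennreal_mono add_left_mono)
  qed simp
  then have "(\<integral>\<^sup>+\<omega>. e2ennreal (ereal d + liminf (\<lambda>n. M (prefix_of_path \<omega> (Suc n)))) \<partial>path_measure p [x])
      = (\<integral>\<^sup>+\<omega>. liminf (\<lambda>n. e2ennreal (ereal d + M (prefix_of_path \<omega> (Suc n)))) \<partial>path_measure p [x])"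
    by simp
  also have "\<dots> \<le> liminf (\<lambda>n. \<integral>\<^sup>+\<omega>. e2ennreal (ereal d + M (prefix_of_path \<omega> (Suc n))) \<partial>path_measure p [x])"
    by (intro nn_integral_liminf measurable_compose[OF measurable_prefix]) simp
  also have "\<dots> \<le> liminf (\<lambda>n. e2ennreal (ereal d + M [x]))"
    by (intro Liminf_mono always_eventually allI supermartingale_integral_le[OF \<T> M d p])
  also have "\<dots> = e2ennreal (ereal d + M [x])"
    by (intro Liminf_const) simp
  finally show ?thesis .
qed

lemma supermartingale_bound:
  assumes "supermartingale Q \<T> M"
  obtains d :: real where "0 \<le> d" "\<And>s. 0 \<le> ereal d + M s"
proof -
  obtain c :: real where c: "\<forall>s. ereal c \<le> M s"
    using assms unfolding supermartingale_def by (elim conjE exE)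
  have "0 \<le> ereal \<bar>c\<bar> + M s" for s
  proof -
    have "ereal \<bar>c\<bar> + ereal c \<le> ereal \<bar>c\<bar> + M s"
      using c by (intro add_left_mono) simp
    moreover have "(0 :: ereal) \<le> ereal \<bar>c\<bar> + ereal c" by simp
    ultimately show ?thesis by (rule order_trans[rotated])
  qed
  then show ?thesis using that[of "\<bar>c\<bar>"] by simp
qed

text \<open>A supermartingale whose limit inferior is at least the hitting time along the paths that start at
  \<open>x\<close>, that is almost surely, has expected limit inferior at least the expected hitting time, and at
  most its value at \<open>[x]\<close>.\<close>

lemma expect_le_upper_expect_V:
  fixes p :: "'x::finite process"
  assumes \<T>: "\<And>T. T \<in> \<T> \<Longrightarrow> transition_matrix T" and p: "p \<in> processes_I \<T>"
  shows "expect p (hitting_time A) [x] \<le> upper_expect_V Q \<T> (hitting_time A) [x]"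
  unfolding upper_expect_V_def
proof (rule Inf_greatest, clarify)
  fix M assume M: "supermartingale Q \<T> M"
    and le: "\<forall>\<omega>. prefix_of_path \<omega> (length [x]) = [x] \<longrightarrow>
      hitting_time A \<omega> \<le> liminf (\<lambda>m. M (prefix_of_path \<omega> (Suc m)))"
  obtain d where d: "0 \<le> d" "\<And>s. 0 \<le> ereal d + M s" using supermartingale_bound[OF M] by blast
  interpret prob_space "path_measure p [x]" by (rule prob_space_path_measure)
  have H: "(\<lambda>\<omega>. e2ennreal (hitting_time A \<omega>)) \<in> borel_measurable (path_measure p [x])"
    by (rule measurable_compose[OF measurable_hitting_time measurable_e2ennreal])
  have "ennreal d + (\<integral>\<^sup>+\<omega>. e2ennreal (hitting_time A \<omega>) \<partial>path_measure p [x])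
      = (\<integral>\<^sup>+\<omega>. ennreal d + e2ennreal (hitting_time A \<omega>) \<partial>path_measure p [x])"
    using H emeasure_space_1 by (subst nn_integral_add) auto
  also have "\<dots> \<le> (\<integral>\<^sup>+\<omega>. e2ennreal (ereal d + liminf (\<lambda>n. M (prefix_of_path \<omega> (Suc n)))) \<partial>path_measure p [x])"
  proof (rule nn_integral_mono_AE, use AE_path_measure_starts_at[where p = p and x = x] in eventually_elim)
    fix \<omega> assume "prefix_of_path \<omega> 1 = [x]"
    then have "hitting_time A \<omega> \<le> liminf (\<lambda>m. M (prefix_of_path \<omega> (Suc m)))" using le by simp
    then have "e2ennreal (ereal d + hitting_time A \<omega>) \<le> e2ennreal (ereal d + liminf (\<lambda>m. M (prefix_of_path \<omega> (Suc m))))"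
      by (intro e2ennreal_mono add_left_mono)
    moreover have "e2ennreal (ereal d + hitting_time A \<omega>) = ennreal d + e2ennreal (hitting_time A \<omega>)"
      using d(1) hitting_time_nonneg[of A \<omega>] by (cases "hitting_time A \<omega>") auto
    ultimately show "ennreal d + e2ennreal (hitting_time A \<omega>) \<le> e2ennreal (ereal d + liminf (\<lambda>m. M (prefix_of_path \<omega> (Suc m))))"
      by simp
  qed
  also have "\<dots> \<le> e2ennreal (ereal d + M [x])"
    by (rule supermartingale_liminf_integral_le[OF \<T> M d(2) p])
  finally have "enn2ereal (ennreal d + (\<integral>\<^sup>+\<omega>. e2ennreal (hitting_time A \<omega>) \<partial>path_measure p [x])) \<le> ereal d + M [x]"
    using d by (simp add: less_eq_ennreal.rep_eq enn2ereal_e2ennreal)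
  then have "ereal d + expect p (hitting_time A) [x] \<le> ereal d + M [x]"
    using d(1) by (simp add: plus_ennreal.rep_eq expect_hitting_time)
  then show "expect p (hitting_time A) [x] \<le> M [x]"
    by (cases "expect p (hitting_time A) [x]"; cases "M [x]") auto
qed

text \<open>The lower expectation is defined through the negated hitting time, whose integral may be \<open>-\<infinity>\<close>. To stay
  with nonnegative integrals, the hitting time is moved to the other side: if the limit inferior is at
  least minus the hitting time, then their sum, shifted by \<open>d\<close>, is at least \<open>d\<close>.\<close>

lemma lower_expect_V_le_expect:
  fixes p :: "'x::finite process"
  assumes \<T>: "\<And>T. T \<in> \<T> \<Longrightarrow> transition_matrix T" and p: "p \<in> processes_I \<T>"
  shows "lower_expect_V Q \<T> (hitting_time A) [x] \<le> expect p (hitting_time A) [x]"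
proof -
  have "- expect p (hitting_time A) [x] \<le> upper_expect_V Q \<T> (\<lambda>\<omega>. - hitting_time A \<omega>) [x]"
    unfolding upper_expect_V_def
  proof (rule Inf_greatest, clarify)
    fix M assume M: "supermartingale Q \<T> M"
      and le: "\<forall>\<omega>. prefix_of_path \<omega> (length [x]) = [x] \<longrightarrow>
        - hitting_time A \<omega> \<le> liminf (\<lambda>m. M (prefix_of_path \<omega> (Suc m)))"
    obtain d where d: "0 \<le> d" "\<And>s. 0 \<le> ereal d + M s" using supermartingale_bound[OF M] by blast
    interpret prob_space "path_measure p [x]" by (rule prob_space_path_measure)
    let ?L = "\<lambda>\<omega>. liminf (\<lambda>m. M (prefix_of_path \<omega> (Suc m)))"
    have L: "(\<lambda>\<omega>. e2ennreal (ereal d + ?L \<omega>)) \<in> borel_measurable (path_measure p [x])"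
      by (intro measurable_compose[OF _ measurable_e2ennreal] borel_measurable_ereal_add
            borel_measurable_const borel_measurable_liminf)
         (rule measurable_compose[OF measurable_prefix], simp)
    have H: "(\<lambda>\<omega>. e2ennreal (hitting_time A \<omega>)) \<in> borel_measurable (path_measure p [x])"
    by (rule measurable_compose[OF measurable_hitting_time measurable_e2ennreal])
    have "ennreal d = (\<integral>\<^sup>+\<omega>. ennreal d \<partial>path_measure p [x])"
      using emeasure_space_1 by simp
    also have "\<dots> \<le> (\<integral>\<^sup>+\<omega>. e2ennreal (ereal d + ?L \<omega>) + e2ennreal (hitting_time A \<omega>) \<partial>path_measure p [x])"
    proof (rule nn_integral_mono_AE, use AE_path_measure_starts_at[where p = p and x = x] in eventually_elim)
      fix \<omega> assume "prefix_of_path \<omega> 1 = [x]"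
      then have *: "- hitting_time A \<omega> \<le> ?L \<omega>" using le by simp
      show "ennreal d \<le> e2ennreal (ereal d + ?L \<omega>) + e2ennreal (hitting_time A \<omega>)"
      proof (cases "hitting_time A \<omega>")
        case (real r)
        have r: "0 \<le> r" using hitting_time_nonneg[of A \<omega>] real by simp
        have "ennreal d \<le> ennreal (d - r) + ennreal r"
          using r d(1) by (cases "r \<le> d") (auto simp: ennreal_plus[symmetric] ennreal_neg ennreal_leI simp del: ennreal_plus)
        also have "ennreal (d - r) \<le> e2ennreal (ereal d + ?L \<omega>)"
          using e2ennreal_mono[OF add_left_mono[OF *, of "ereal d"]] real by simp
        finally show ?thesis using real by (simp add: add_right_mono)
      qed (use hitting_time_nonneg[of A \<omega>] in auto)
    qed
    also have "\<dots> = (\<integral>\<^sup>+\<omega>. e2ennreal (ereal d + ?L \<omega>) \<partial>path_measure p [x])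
        + (\<integral>\<^sup>+\<omega>. e2ennreal (hitting_time A \<omega>) \<partial>path_measure p [x])"
      by (intro nn_integral_add L H)
    also have "\<dots> \<le> e2ennreal (ereal d + M [x]) + (\<integral>\<^sup>+\<omega>. e2ennreal (hitting_time A \<omega>) \<partial>path_measure p [x])"
      by (intro add_right_mono supermartingale_liminf_integral_le[OF \<T> M d(2) p])
    finally have "ereal d \<le> ereal d + M [x] + expect p (hitting_time A) [x]"
      using d by (simp add: less_eq_ennreal.rep_eq enn2ereal_e2ennreal plus_ennreal.rep_eq expect_hitting_time)
    moreover have "M [x] \<noteq> -\<infinity>" using d(2)[of "[x]"] by auto
    moreover have "0 \<le> expect p (hitting_time A) [x]" by (simp add: expect_hitting_time)
    ultimately show "- expect p (hitting_time A) [x] \<le> M [x]"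
      by (cases "expect p (hitting_time A) [x]"; cases "M [x]") auto
  qed
  then show ?thesis unfolding lower_expect_V_def by (metis ereal_uminus_le_reorder)
qed

section \<open>Finite horizons\<close>

lemma ex_homogeneous_Markov_chain:
  assumes "transition_matrix T"
  shows "\<exists>p. homogeneous_Markov_chain T p"
proof -
  have "pmf (embed_pmf (\<lambda>y. T $ x $ y)) y = T $ x $ y" for x y
    using assms unfolding transition_matrix_def
    by (intro pmf_embed_pmf) (auto simp: nn_integral_count_space_finite sum_ennreal)
  then have "homogeneous_Markov_chain T (\<lambda>s. embed_pmf (\<lambda>y. T $ last s $ y))"
    by (simp add: homogeneous_Markov_chain_def)
  then show ?thesis by blast
qed

text \<open>Monotone convergence: a one-step inequality that holds along an increasing sequence passes to its
  supremum, even where the supremum is infinite.\<close>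

lemma one_add_trans_op_SUP_le:
  fixes f :: "nat \<Rightarrow> 'x::finite \<Rightarrow> real"
  assumes T: "transition_matrix T"
    and inc: "\<And>n y. f n y \<le> f (Suc n) y" and nonneg: "\<And>n y. 0 \<le> f n y"
    and le: "\<And>n. ereal (1 + act T (f n) x) \<le> G"
  shows "1 + trans_op T (\<lambda>y. SUP n. ereal (f n y)) x \<le> G"
proof -
  have "trans_op T (\<lambda>y. SUP n. ereal (f n y)) x = (\<Sum>y\<in>UNIV. SUP n. ereal (T $ x $ y) * ereal (f n y))"
    unfolding trans_op_def using T nonneg
    by (intro sum.cong refl SUP_ereal_mult_left[symmetric]) (auto simp: transition_matrix_def)
  also have "\<dots> = (SUP n. \<Sum>y\<in>UNIV. ereal (T $ x $ y) * ereal (f n y))"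
    using T inc nonneg
    by (intro SUP_ereal_sum[symmetric] incseq_SucI)
       (auto simp: transition_matrix_def intro!: mult_left_mono)
  also have "\<dots> = (SUP n. ereal (act T (f n) x))"
    by (simp add: act_def)
  finally have "1 + trans_op T (\<lambda>y. SUP n. ereal (f n y)) x = (SUP n. 1 + ereal (act T (f n) x))"
    by (simp only: SUP_ereal_add_right[OF UNIV_not_empty] ereal.distinct one_ereal_def
        not_False_eq_True MInfty_neq_ereal)
  also have "\<dots> \<le> G" using le by (intro SUP_least) (simp add: one_ereal_def)
  finally show ?thesis .
qed

text \<open>With \<open>U\<close> the upper, lower or precise expectation, this is the upper, lower or precise expectation of
  the hitting time capped at \<open>n\<close>.\<close>

primrec truncated_time :: "(('x \<Rightarrow> real) \<Rightarrow> 'x \<Rightarrow> real) \<Rightarrow> 'x set \<Rightarrow> nat \<Rightarrow> 'x \<Rightarrow> real" where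
  "truncated_time U A 0 = (\<lambda>_. 0)"
| "truncated_time U A (Suc n) = (\<lambda>x. if x \<in> A then 0 else 1 + U (truncated_time U A n) x)"

text \<open>Correspondingly, the (upper, lower or precise) probability that \<open>A\<close> is not visited at the times
  \<open>0, \<dots>, n\<close>.\<close>

primrec survival_prob :: "(('x \<Rightarrow> real) \<Rightarrow> 'x \<Rightarrow> real) \<Rightarrow> 'x set \<Rightarrow> nat \<Rightarrow> 'x \<Rightarrow> real" where
  "survival_prob U A 0 = (\<lambda>x. if x \<in> A then 0 else 1)"
| "survival_prob U A (Suc n) = (\<lambda>x. if x \<in> A then 0 else U (survival_prob U A n) x)"

lemma truncated_time_inc:
  assumes mono: "\<And>f g x. (\<And>y. f y \<le> g y) \<Longrightarrow> U f x \<le> U g x" and zero: "\<And>x. 0 \<le> U (\<lambda>_. 0) x"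
  shows "truncated_time U A n x \<le> truncated_time U A (Suc n) x"
proof (induction n arbitrary: x)
  case 0 show ?case using zero by (auto intro: add_nonneg_nonneg)
next
  case (Suc n)
  have "U (truncated_time U A n) x \<le> U (truncated_time U A (Suc n)) x"
    by (rule mono) (rule Suc.IH)
  then show ?case by simp
qed

lemma truncated_time_nonneg:
  assumes mono: "\<And>f g x. (\<And>y. f y \<le> g y) \<Longrightarrow> U f x \<le> U g x" and zero: "\<And>x. 0 \<le> U (\<lambda>_. 0) x"
  shows "0 \<le> truncated_time U A n x"
proof -
  have "incseq (\<lambda>n. truncated_time U A n x)"
    by (rule incseq_SucI) (rule truncated_time_inc[of U, OF assms])
  from incseqD[OF this, of 0 n] show ?thesis by simp
qed

lemma truncated_time_in_A: "x \<in> A \<Longrightarrow> truncated_time U A n x = 0"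
  by (cases n) auto

lemma homogeneous_in_processes_I:
  assumes "homogeneous_Markov_chain T p" "T \<in> \<T>" shows "p \<in> processes_I \<T>"
  using assms unfolding homogeneous_Markov_chain_def processes_I_def by blast

text \<open>A single transition matrix is the special case of a one-element set, so the game-theoretic bounds also
  bound the expectations of a precise chain.\<close>

lemma truncated_time_le_expect:
  assumes T: "transition_matrix T" and p: "homogeneous_Markov_chain T p"
  shows "ereal (truncated_time (act T) A n x) \<le> expect p (hitting_time A) [x]"
proof -
  have "ereal (truncated_time (act T) A n x) \<le> lower_expect_V (\<lambda>_. 0) {T} (hitting_time A) [x]"
    using T by (intro subsolution_le_lower_expect_V) (auto simp: truncated_time_in_A)
  also have "\<dots> \<le> expect p (hitting_time A) [x]"
    using T homogeneous_in_processes_I[OF p] by (intro lower_expect_V_le_expect) auto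
  finally show ?thesis .
qed

lemma expect_le_supersolution:
  assumes T: "transition_matrix T" and p: "homogeneous_Markov_chain T p"
    and "\<And>x. 0 \<le> h x" "\<And>x. x \<notin> A \<Longrightarrow> 1 + trans_op T h x \<le> h x"
  shows "expect p (hitting_time A) [x] \<le> h x"
proof -
  have "expect p (hitting_time A) [x] \<le> upper_expect_V (\<lambda>_. 0) {T} (hitting_time A) [x]"
    using T homogeneous_in_processes_I[OF p] by (intro expect_le_upper_expect_V) auto
  also have "\<dots> \<le> h x"
    using assms by (intro upper_expect_V_le_supersolution) auto
  finally show ?thesis .
qed

context credal_matrices
begin

lemma upper_zero: "upper (\<lambda>_. 0) x = 0"
  using upper_attained[of "\<lambda>_. 0" x] stochastic by (auto simp: act_const)

lemma lower_zero: "lower (\<lambda>_. 0) x = 0"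
  using upper_zero by (simp add: lower_def)

end

section \<open>Bounds by limits of finite horizons\<close>

locale imprecise_hitting = credal_matrices +
  fixes A :: "'a set"
  assumes rows: "separately_specified_rows \<T>"
begin

abbreviation low_time :: "nat \<Rightarrow> 'a \<Rightarrow> real" where "low_time \<equiv> truncated_time lower A"
abbreviation up_time :: "nat \<Rightarrow> 'a \<Rightarrow> real" where "up_time \<equiv> truncated_time upper A"

abbreviation survival :: "nat \<Rightarrow> 'a \<Rightarrow> real" where "survival \<equiv> survival_prob upper A"

lemma low_time_inc: "low_time n x \<le> low_time (Suc n) x"
  by (rule truncated_time_inc) (auto simp: lower_zero intro: lower_mono)

lemma low_time_nonneg: "0 \<le> low_time n x"
  by (rule truncated_time_nonneg) (auto simp: lower_zero intro: lower_mono)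

lemma up_time_inc: "up_time n x \<le> up_time (Suc n) x"
  by (rule truncated_time_inc) (auto simp: upper_zero intro: upper_mono)

lemma up_time_nonneg: "0 \<le> up_time n x"
  by (rule truncated_time_nonneg) (auto simp: upper_zero intro: upper_mono)

text \<open>Separately specified rows allow an optimal row to be chosen for each state on its own.\<close>

lemma glue_rows:
  assumes "\<And>x. \<exists>T\<in>\<T>. P x (T $ x)"
  shows "\<exists>T\<in>\<T>. \<forall>x. P x (T $ x)"
proof -
  obtain R where "\<And>x. R x \<in> \<T> \<and> P x (R x $ x)" using assms by metis
  moreover from this obtain T where "T \<in> \<T>" "\<forall>x. T $ x = R x $ x"
    using rows unfolding separately_specified_rows_def by blast
  ultimately show ?thesis by metis
qed

lemma low_time_le_lower_expect_V: "(SUP n. ereal (low_time n x)) \<le> lower_expect_V Q \<T> (hitting_time A) [x]"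
  by (intro SUP_least subsolution_le_lower_expect_V)
     (auto simp: truncated_time_in_A stochastic lower_le_act)

lemma upper_expect_V_le_up_time: "upper_expect_V Q \<T> (hitting_time A) [x] \<le> (SUP n. ereal (up_time n x))"
proof (rule upper_expect_V_le_supersolution)
  fix x T assume *: "x \<notin> A" "T \<in> \<T>"
  show "1 + trans_op T (\<lambda>y. SUP n. ereal (up_time n y)) x \<le> (SUP n. ereal (up_time n x))"
  proof (rule one_add_trans_op_SUP_le)
    fix n
    have "1 + act T (up_time n) x \<le> up_time (Suc n) x"
      using * act_le_upper by simp
    then show "ereal (1 + act T (up_time n) x) \<le> (SUP n. ereal (up_time n x))"
      by (intro SUP_upper2[of "Suc n"]) auto
  qed (use * stochastic up_time_inc up_time_nonneg in auto)
next
  fix y show "0 \<le> (SUP n. ereal (up_time n y))"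
    by (intro SUP_upper2[of 0]) auto
qed (rule stochastic)

section \<open>A chain that attains the lower expectation\<close>

text \<open>At each state outside \<open>A\<close> with finite limit, compactness provides one row that keeps one plus
  the expected capped time at or below the limit at all horizons. By monotone convergence, the matrix
  of these rows makes the limit itself a supersolution.\<close>

lemma ex_lower_optimal:
  "\<exists>T\<in>\<T>. \<forall>p x. homogeneous_Markov_chain T p \<longrightarrow>
     expect p (hitting_time A) [x] \<le> (SUP n. ereal (low_time n x))"
proof -
  let ?g = "\<lambda>x. SUP n. ereal (low_time n x)"
  have "\<exists>T\<in>\<T>. x \<notin> A \<longrightarrow> (\<forall>n. ereal (1 + (\<Sum>y\<in>UNIV. T $ x $ y * low_time n y)) \<le> ?g x)" for x
  proof (cases "x \<in> A \<or> ?g x = \<infinity>")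
    case True
    then show ?thesis using nonempty by auto
  next
    case False
    have "ereal (low_time 0 x) \<le> ?g x" by (intro SUP_upper) auto
    with False obtain L where L: "?g x = ereal L" by (cases "?g x") auto
    have "\<exists>T\<in>\<T>. \<forall>n. 1 - L \<le> act T (\<lambda>y. - low_time n y) x"
    proof (rule ex_uniform_matrix)
      fix n
      obtain T where T: "T \<in> \<T>" "lower (low_time n) x = act T (low_time n) x"
        using lower_attained by blast
      have "ereal (low_time (Suc n) x) \<le> ?g x" by (rule SUP_upper) simp
      then have "1 + act T (low_time n) x \<le> L" using False T L by simp
      then show "\<exists>T\<in>\<T>. 1 - L \<le> act T (\<lambda>y. - low_time n y) x"
        using T(1) by (intro bexI[of _ T]) (auto simp: act_minus)
    qed (use low_time_inc in simp)
    then obtain T where "T \<in> \<T>" "\<And>n. 1 - L \<le> - act T (low_time n) x"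
      by (auto simp: act_minus)
    moreover from this(2) have "1 + act T (low_time n) x \<le> L" for n
      by (smt (verit))
    ultimately show ?thesis unfolding L act_def by auto
  qed
  from glue_rows[OF this] obtain T where T: "T \<in> \<T>"
    "\<And>x n. x \<notin> A \<Longrightarrow> ereal (1 + act T (low_time n) x) \<le> ?g x"
    unfolding act_def by blast
  have "expect p (hitting_time A) [x] \<le> ?g x" if "homogeneous_Markov_chain T p" for p x
  proof (rule expect_le_supersolution[OF stochastic[OF T(1)] that])
    show "0 \<le> ?g y" for y by (intro SUP_upper2[of 0]) auto
    show "1 + trans_op T ?g y \<le> ?g y" if "y \<notin> A" for y
      by (rule one_add_trans_op_SUP_le) (rule stochastic low_time_inc low_time_nonneg T that)+
  qed
  then show ?thesis using T(1) by blast
qed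

section \<open>A chain that attains the upper expectation\<close>

lemma survival_nonneg: "0 \<le> survival n x"
proof (induction n arbitrary: x)
  case (Suc n)
  have "upper (\<lambda>_. 0) x \<le> upper (survival n) x" by (rule upper_mono) (rule Suc.IH)
  then show ?case by (simp add: upper_zero)
qed simp

lemma survival_dec: "survival (Suc n) x \<le> survival n x"
proof (induction n arbitrary: x)
  case 0
  obtain T where T: "T \<in> \<T>" "upper (survival 0) x = act T (survival 0) x"
    using upper_attained by blast
  have "act T (survival 0) x \<le> act T (\<lambda>_. 1) x"
    by (intro act_mono_support stochastic T) simp
  then show ?case using T act_const[OF stochastic[OF T(1)]] by simp
next
  case (Suc n)
  have "upper (survival (Suc n)) x \<le> upper (survival n) x" by (rule upper_mono) (rule Suc.IH)
  then show ?case by simp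
qed

text \<open>The largest probability with which \<open>A\<close> can be avoided forever. Where it is positive, the upper expected
  hitting time is infinite; where it is zero, the upper expected hitting time turns out to be finite.\<close>

definition avoidance :: "'a \<Rightarrow> real" where
  "avoidance x = (INF n. survival n x)"

lemma survival_tendsto_avoidance: "(\<lambda>n. survival n x) \<longlonglongrightarrow> avoidance x"
  unfolding avoidance_def
  by (intro LIMSEQ_decseq_INF decseq_SucI survival_dec bdd_belowI[of _ 0]) (auto simp: survival_nonneg)

lemma avoidance_le_survival: "avoidance x \<le> survival n x"
  by (rule decseq_ge[OF _ survival_tendsto_avoidance]) (intro decseq_SucI survival_dec)

lemma avoidance_nonneg: "0 \<le> avoidance x"
  by (rule LIMSEQ_le_const[OF survival_tendsto_avoidance]) (auto simp: survival_nonneg)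

lemma ex_avoiding_row:
  assumes "x \<notin> A"
  shows "\<exists>T\<in>\<T>. avoidance x \<le> act T avoidance x"
proof -
  have "\<exists>T\<in>\<T>. \<forall>n. avoidance x \<le> act T (survival n) x"
  proof (rule ex_uniform_matrix)
    fix n
    obtain T where "T \<in> \<T>" "upper (survival n) x = act T (survival n) x"
      using upper_attained by blast
    then show "\<exists>T\<in>\<T>. avoidance x \<le> act T (survival n) x"
      using avoidance_le_survival[of x "Suc n"] assms by (intro bexI[of _ T]) auto
  qed (rule survival_dec)
  then obtain T where T: "T \<in> \<T>" "\<And>n. avoidance x \<le> act T (survival n) x" by blast
  have "avoidance x \<le> act T avoidance x"
    by (rule LIMSEQ_le_const[OF tendsto_act[OF survival_tendsto_avoidance]]) (use T in auto)
  then show ?thesis using T(1) by blast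
qed

text \<open>From a state outside \<open>A\<close> where \<open>A\<close> cannot be avoided, no row leads to a state where it can.\<close>

lemma avoidance_zero_closed:
  assumes "x \<notin> A" "avoidance x = 0" "T \<in> \<T>" "T $ x $ y \<noteq> 0"
  shows "avoidance y = 0"
proof -
  have "act T avoidance x \<le> survival (Suc n) x" for n
  proof -
    have "act T avoidance x \<le> act T (survival n) x"
      by (intro act_mono_support stochastic assms avoidance_le_survival)
    also have "\<dots> \<le> survival (Suc n) x"
      using assms act_le_upper by simp
    finally show ?thesis .
  qed
  then have "act T avoidance x \<le> avoidance x"
    by (intro LIMSEQ_le_const[OF LIMSEQ_Suc[OF survival_tendsto_avoidance]]) auto
  moreover have nn: "0 \<le> T $ x $ y * avoidance y" for y
    using stochastic[OF assms(3)] avoidance_nonneg by (simp add: transition_matrix_def)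
  ultimately have "(\<Sum>y\<in>UNIV. T $ x $ y * avoidance y) = 0"
    using assms(2) by (intro antisym sum_nonneg) (auto simp: act_def)
  then have "T $ x $ y * avoidance y = 0"
    using nn by (subst (asm) sum_nonneg_eq_0_iff) auto
  then show ?thesis using assms(4) by simp
qed

lemma up_time_le_index: "up_time n x \<le> real n"
proof (induction n arbitrary: x)
  case (Suc n)
  obtain T where T: "T \<in> \<T>" "upper (up_time n) x = act T (up_time n) x"
    using upper_attained by blast
  have "act T (up_time n) x \<le> act T (\<lambda>_. real n) x"
    by (intro act_mono_support stochastic T Suc.IH)
  then show ?case using T act_const[OF stochastic[OF T(1)]] by simp
qed simp

text \<open>After \<open>j\<close> steps the remaining time matters only if \<open>A\<close> has not been visited yet.\<close>

lemma up_time_add_le: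
  assumes B: "\<And>x. avoidance x = 0 \<Longrightarrow> up_time m x \<le> B" and x: "avoidance x = 0"
  shows "up_time (j + m) x \<le> up_time j x + B * survival j x"
  using x
proof (induction j arbitrary: x)
  case 0
  then show ?case using B by (auto simp: truncated_time_in_A)
next
  case (Suc j)
  have "0 \<le> B" using B[OF Suc.prems] up_time_nonneg[of m x] by linarith
  show ?case
  proof (cases "x \<in> A")
    case False
    obtain T where T: "T \<in> \<T>" "upper (up_time (j + m)) x = act T (up_time (j + m)) x"
      using upper_attained by blast
    have "act T (up_time (j + m)) x \<le> act T (\<lambda>y. up_time j y + B * survival j y) x"
      using avoidance_zero_closed[OF False Suc.prems T(1)] Suc.IH
      by (intro act_mono_support stochastic T) blast
    also have "\<dots> = act T (up_time j) x + B * act T (survival j) x"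
      by (simp add: act_add act_scale)
    also have "\<dots> \<le> upper (up_time j) x + B * upper (survival j) x"
      using \<open>0 \<le> B\<close> T(1) by (intro add_mono mult_left_mono act_le_upper) auto
    finally show ?thesis using False T by simp
  qed simp
qed

text \<open>There are only finitely many states, so after some \<open>k\<close> steps the probability of not having visited \<open>A\<close>
  is at most one half from each state where \<open>A\<close> cannot be avoided. A bound \<open>B\<close> therefore reproduces itself
  if \<open>k + B / 2 = B\<close>.\<close>

lemma up_time_bounded:
  "\<exists>B\<ge>0. \<forall>n x. avoidance x = 0 \<longrightarrow> up_time n x \<le> B"
proof -
  have "eventually (\<lambda>n. survival n x \<le> 1/2) sequentially" if "avoidance x = 0" for x
    using order_tendstoD(2)[OF survival_tendsto_avoidance[of x], of "1/2"] that
    by (auto elim: eventually_mono)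
  then have "eventually (\<lambda>n. \<forall>x\<in>{x. avoidance x = 0}. survival n x \<le> 1/2) sequentially"
    by (intro eventually_ball_finite) auto
  then obtain N where N: "\<And>n x. n \<ge> N \<Longrightarrow> avoidance x = 0 \<Longrightarrow> survival n x \<le> 1/2"
    by (auto simp: eventually_sequentially)
  \<comment> \<open>A positive number of steps is needed for the induction on the horizon.\<close>
  define k where "k = Suc N"
  have k: "survival k x \<le> 1/2" if "avoidance x = 0" for x
    using N[OF _ that] by (simp add: k_def del: survival_prob.simps)
  have "up_time n x \<le> 2 * real k" if "avoidance x = 0" for n x
    using that
  proof (induction n arbitrary: x rule: less_induct)
    case (less n)
    show ?case
    proof (cases "n \<le> k")
      case True
      then show ?thesis using up_time_le_index[of n x] by linarith
    next
      case False
      then have "up_time (k + (n - k)) x \<le> up_time k x + (2 * real k) * survival k x"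
        using less.prems less.IH[of "n - k"] by (intro up_time_add_le) (auto simp: k_def)
      moreover have "(2 * real k) * survival k x \<le> (2 * real k) * (1/2)"
        using k[OF less.prems] by (intro mult_left_mono) auto
      ultimately show ?thesis
        using False up_time_le_index[of k x] by simp
    qed
  qed
  then show ?thesis by (intro exI[of _ "2 * real k"]) auto
qed

text \<open>Rows are chosen by one rule where \<open>A\<close> can be avoided and by another where it cannot. In the first case
  they preserve the avoidance probability, which makes the capped hitting times of the chain grow
  linearly. In the second case they maximise the expectation of the limit of the upper capped hitting
  times, which is real-valued there; the capped hitting times of the chain then fall short of this limit
  by at most a multiple of the survival probability, which tends to zero.\<close>

lemma ex_upper_optimal:
  "\<exists>T\<in>\<T>. \<forall>p x. homogeneous_Markov_chain T p \<longrightarrow>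
     (SUP n. ereal (up_time n x)) \<le> expect p (hitting_time A) [x]"
proof -
  obtain B where B: "0 \<le> B" "\<And>n x. avoidance x = 0 \<Longrightarrow> up_time n x \<le> B"
    using up_time_bounded by blast
  \<comment> \<open>The value \<open>0\<close> where \<open>A\<close> can be avoided is never seen: rows at states where it cannot be avoided put no
    mass there.\<close>
  define limit where "limit x = (if avoidance x = 0 then SUP n. up_time n x else 0)" for x
  have up_le_limit: "up_time n x \<le> limit x" if "avoidance x = 0" for n x
    using that B(2)[OF that] by (auto simp: limit_def intro!: cSUP_upper bdd_aboveI)
  have limit_le: "limit x \<le> c" if "avoidance x = 0" "\<And>n. up_time n x \<le> c" for c x
    using that by (auto simp: limit_def intro!: cSUP_least)
  have "\<exists>T\<in>\<T>. x \<notin> A \<longrightarrow> avoidance x \<le> (\<Sum>y\<in>UNIV. T $ x $ y * avoidance y) \<and>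
      (avoidance x = 0 \<longrightarrow> limit x \<le> 1 + (\<Sum>y\<in>UNIV. T $ x $ y * limit y))" for x
  proof (cases "x \<notin> A \<and> avoidance x = 0")
    case True
    obtain T where T: "T \<in> \<T>" "\<And>S. S \<in> \<T> \<Longrightarrow> act S limit x \<le> act T limit x"
      using ex_maximal_row by blast
    have "limit x \<le> 1 + act T limit x"
    proof (rule limit_le)
      fix n
      obtain S where S: "S \<in> \<T>" "upper (up_time n) x = act S (up_time n) x"
        using upper_attained by blast
      have "up_time n x \<le> up_time (Suc n) x" by (rule up_time_inc)
      also have "\<dots> = 1 + act S (up_time n) x" using True S by simp
      also have "act S (up_time n) x \<le> act S limit x"
        using avoidance_zero_closed[OF _ _ S(1)] True
        by (intro act_mono_support stochastic S up_le_limit) blast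
      also have "act S limit x \<le> act T limit x" by (rule T(2)[OF S(1)])
      finally show "up_time n x \<le> 1 + act T limit x" by simp
    qed (use True in simp)
    moreover have "0 \<le> act T avoidance x"
      unfolding act_def using stochastic[OF T(1)] avoidance_nonneg
      by (intro sum_nonneg) (auto simp: transition_matrix_def)
    ultimately show ?thesis using T(1) True by (auto simp: act_def)
  next
    case False
    show ?thesis
    proof (cases "x \<in> A")
      case True
      then show ?thesis using nonempty by blast
    next
      case nA: False
      with ex_avoiding_row[OF nA] False show ?thesis by (auto simp: act_def)
    qed
  qed
  from glue_rows[OF this] obtain T where T: "T \<in> \<T>"
    and avoiding: "\<And>x. x \<notin> A \<Longrightarrow> avoidance x \<le> act T avoidance x"
    and maximal: "\<And>x. x \<notin> A \<Longrightarrow> avoidance x = 0 \<Longrightarrow> limit x \<le> 1 + act T limit x"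
    unfolding act_def by blast
  let ?e = "truncated_time (act T) A"
  have linear: "real n * avoidance x \<le> ?e n x" for n x
  proof (induction n arbitrary: x)
    case (Suc n)
    show ?case
    proof (cases "x \<in> A")
      case True
      then show ?thesis using avoidance_le_survival[of x 0] avoidance_nonneg[of x] by simp
    next
      case False
      have "avoidance x \<le> 1" using avoidance_le_survival[of x 0] False by simp
      moreover have "real n * avoidance x \<le> real n * act T avoidance x"
        by (intro mult_left_mono avoiding False) simp
      moreover have "real n * act T avoidance x \<le> act T (?e n) x"
        unfolding act_scale[symmetric] by (intro act_mono_support stochastic T Suc.IH)
      ultimately show ?thesis using False by (simp add: algebra_simps)
    qed
  qed simp
  have close: "limit x \<le> ?e n x + B * survival n x" if "avoidance x = 0" for n x
    using that
  proof (induction n arbitrary: x)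
    case 0
    then show ?case
      using limit_le[OF 0 B(2)[OF 0]] limit_le[OF 0, of 0] by (auto simp: truncated_time_in_A)
  next
    case (Suc n)
    show ?case
    proof (cases "x \<in> A")
      case True
      then show ?thesis using limit_le[OF Suc.prems, of 0] by (auto simp: truncated_time_in_A)
    next
      case False
      have "act T limit x \<le> act T (\<lambda>y. ?e n y + B * survival n y) x"
        using avoidance_zero_closed[OF False Suc.prems T]
        by (intro act_mono_support stochastic T Suc.IH) blast
      also have "\<dots> = act T (?e n) x + B * act T (survival n) x"
        by (simp add: act_add act_scale)
      also have "\<dots> \<le> act T (?e n) x + B * upper (survival n) x"
        using B(1) T by (intro add_left_mono mult_left_mono act_le_upper)
      finally show ?thesis using maximal[OF False Suc.prems] False by simp
    qed
  qed
  have "(SUP n. ereal (up_time n x)) \<le> expect p (hitting_time A) [x]"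
    if p: "homogeneous_Markov_chain T p" for p x
  proof (rule SUP_least)
    fix m
    have e: "ereal (?e n x) \<le> expect p (hitting_time A) [x]" for n
      by (rule truncated_time_le_expect[OF stochastic[OF T] p])
    show "ereal (up_time m x) \<le> expect p (hitting_time A) [x]"
    proof (cases "expect p (hitting_time A) [x]")
      case (real r)
      then have r: "?e n x \<le> r" for n using e[of n] by simp
      \<comment> \<open>A finite expectation excludes linear growth.\<close>
      have "avoidance x = 0"
      proof (rule ccontr)
        assume "avoidance x \<noteq> 0"
        then obtain n where "r < real n * avoidance x"
          using reals_Archimedean3[of "avoidance x"] avoidance_nonneg[of x] by fastforce
        then show False using linear[of n x] r[of n] by simp
      qed
      have "(\<lambda>n. B * survival n x) \<longlonglongrightarrow> B * 0"
        using survival_tendsto_avoidance[of x] \<open>avoidance x = 0\<close> by (intro tendsto_intros) simp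
      moreover have "limit x - r \<le> B * survival n x" for n
        using close[OF \<open>avoidance x = 0\<close>, of n] r[of n] by simp
      ultimately have "limit x - r \<le> B * 0"
        by (intro LIMSEQ_le_const) auto
      then show ?thesis using up_le_limit[OF \<open>avoidance x = 0\<close>, of m] real by simp
    qed (use e[of 0] in auto)
  qed
  then show ?thesis using T by blast
qed

end

section \<open>The hitting time under imprecise Markov chains\<close>

theorem theorem12:
  fixes A :: "'x::finite set"
    and \<T> :: "(real^'x^'x) set"
    and Q :: "('x \<Rightarrow> ereal) \<Rightarrow> ereal"
  assumes "\<T> \<noteq> {}" and "closed \<T>" and "convex \<T>"
    and "\<forall>T\<in>\<T>. transition_matrix T"
    and "separately_specified_rows \<T>"
    and "initial_upper_model Q"
  shows "(\<exists>p\<in>processes_H \<T>. \<forall>x.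
            lower_expect_V Q \<T> (hitting_time A) [x] = lower_expect (processes_I \<T>) (hitting_time A) [x] \<and>
            lower_expect (processes_I \<T>) (hitting_time A) [x] = lower_expect (processes_H \<T>) (hitting_time A) [x] \<and>
            lower_expect (processes_H \<T>) (hitting_time A) [x] = expect p (hitting_time A) [x]) \<and>
         (\<exists>p\<in>processes_H \<T>. \<forall>x.
            upper_expect_V Q \<T> (hitting_time A) [x] = upper_expect (processes_I \<T>) (hitting_time A) [x] \<and>
            upper_expect (processes_I \<T>) (hitting_time A) [x] = upper_expect (processes_H \<T>) (hitting_time A) [x] \<and>
            upper_expect (processes_H \<T>) (hitting_time A) [x] = expect p (hitting_time A) [x])"
proof
  interpret imprecise_hitting \<T> A
    using assms by unfold_locales auto
  have H_sub_I: "processes_H \<T> \<subseteq> processes_I \<T>"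
    by (auto simp: processes_H_def intro: homogeneous_in_processes_I)
  let ?E = "\<lambda>p x. expect p (hitting_time A) [x]"
  let ?V = "\<lambda>x. lower_expect_V Q \<T> (hitting_time A) [x]"
  let ?W = "\<lambda>x. upper_expect_V Q \<T> (hitting_time A) [x]"
  have V_le_I: "?V x \<le> lower_expect (processes_I \<T>) (hitting_time A) [x]" for x
    unfolding lower_expect_def by (intro INF_greatest lower_expect_V_le_expect stochastic)
  have I_le_H: "lower_expect (processes_I \<T>) (hitting_time A) [x]
      \<le> lower_expect (processes_H \<T>) (hitting_time A) [x]" for x
    unfolding lower_expect_def by (rule INF_superset_mono[OF H_sub_I]) simp
  have W_ge_I: "upper_expect (processes_I \<T>) (hitting_time A) [x] \<le> ?W x" for x
    unfolding upper_expect_def by (intro SUP_least expect_le_upper_expect_V stochastic)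
  have I_ge_H: "upper_expect (processes_H \<T>) (hitting_time A) [x]
      \<le> upper_expect (processes_I \<T>) (hitting_time A) [x]" for x
    unfolding upper_expect_def by (rule SUP_subset_mono[OF H_sub_I]) simp
  show "\<exists>p\<in>processes_H \<T>. \<forall>x.
      ?V x = lower_expect (processes_I \<T>) (hitting_time A) [x] \<and>
      lower_expect (processes_I \<T>) (hitting_time A) [x] = lower_expect (processes_H \<T>) (hitting_time A) [x] \<and>
      lower_expect (processes_H \<T>) (hitting_time A) [x] = ?E p x"
  proof -
    obtain T where T: "T \<in> \<T>" "\<And>p x. homogeneous_Markov_chain T p \<Longrightarrow> ?E p x \<le> (SUP n. ereal (low_time n x))"
      using ex_lower_optimal by blast
    obtain p where p: "homogeneous_Markov_chain T p"
      using ex_homogeneous_Markov_chain[OF stochastic[OF T(1)]] by blast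
    then have pH: "p \<in> processes_H \<T>" using T(1) by (auto simp: processes_H_def)
    \<comment> \<open>The expectation of \<open>p\<close> lies at both ends of the chain of inequalities, which forces equality.\<close>
    have "lower_expect (processes_H \<T>) (hitting_time A) [x] \<le> ?E p x" for x
      unfolding lower_expect_def using pH by (rule INF_lower)
    moreover have "?E p x \<le> ?V x" for x
      using T(2)[OF p] low_time_le_lower_expect_V by (rule order_trans)
    ultimately show ?thesis
      using pH V_le_I I_le_H by (intro bexI[of _ p]) (meson antisym order_trans)
  qed
  show "\<exists>p\<in>processes_H \<T>. \<forall>x.
      ?W x = upper_expect (processes_I \<T>) (hitting_time A) [x] \<and>
      upper_expect (processes_I \<T>) (hitting_time A) [x] = upper_expect (processes_H \<T>) (hitting_time A) [x] \<and>
      upper_expect (processes_H \<T>) (hitting_time A) [x] = ?E p x"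
  proof -
    obtain T where T: "T \<in> \<T>" "\<And>p x. homogeneous_Markov_chain T p \<Longrightarrow> (SUP n. ereal (up_time n x)) \<le> ?E p x"
      using ex_upper_optimal by blast
    obtain p where p: "homogeneous_Markov_chain T p"
      using ex_homogeneous_Markov_chain[OF stochastic[OF T(1)]] by blast
    then have pH: "p \<in> processes_H \<T>" using T(1) by (auto simp: processes_H_def)
    have "?E p x \<le> upper_expect (processes_H \<T>) (hitting_time A) [x]" for x
      unfolding upper_expect_def using pH by (rule SUP_upper)
    moreover have "?W x \<le> ?E p x" for x
      using upper_expect_V_le_up_time T(2)[OF p] by (rule order_trans)
    ultimately show ?thesis
      using pH W_ge_I I_ge_H by (intro bexI[of _ p]) (meson antisym order_trans)
  qed
qed

end
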